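(* Let $D'\le n'$ be positive integers. Consider any algorithm $A$ that solves rendezvous for agents with labels from the set $\{1,\dots,L\}$. There exist $n\in\Theta(n')$ and $D\in\Theta(D')$ such that, if $A$ takes time $O(D)$ in all $n$-node graphs whenever the initial distance between the agents is $D$, then the required size of advice is $\Omega(D\log(n/D)+\log\log L)$.
   Context: Rendezvous model: the network is an undirected connected graph with $n$ unlabeled nodes; at each node $v$ of degree $d$ the incident edges carry distinct port numbers $0,\dots,d-1$ (local numbering). Two agents start at different nodes and move in synchronous rounds: in each round an agent either stays or chooses a port and moves along the corresponding edge; on entering a node it learns the degree and entry port. Agents cannot mark nodes, cannot communicate before meeting, and do not notice crossing inside an edge. Each agent has a distinct label from $\{1,\dots,L\}$, knows its own label but not the other's. The adversary wakes the agents possibly in different rounds; each starts the algorithm at its wake-up. Both run the same deterministic algorithm with inputs its own label and an advice string given identically to both agents by an oracle knowing the whole instance (graph, port numbering, starting positions, wake-up rounds, both labels); the size of advice is the length of this binary string. Rendezvous means both agents at the same node in the same round; time is the number of rounds from the wake-up of the later agent until the meeting. $D$ is the distance between the agents' initial positions. *)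

theory Defs
  imports Complex_Main "Graph_Theory.Graph_Theory"
begin

section \<open>Port-labelled networks\<close>

text \<open>A finite simple undirected graph is a \<open>pair_graph\<close>, i.e. a finite loop-free digraph with a
  symmetric arc relation; an undirected edge is a pair of opposite arcs. \<open>port N u v\<close> is the
  number that the edge between \<open>u\<close> and \<open>v\<close> carries at its endpoint \<open>u\<close>; it is relevant only for
  adjacent \<open>u\<close>, \<open>v\<close>. Node names serve only to describe the network: agents never perceive them.\<close>

record network =
  graph :: "nat pair_pre_digraph"
  port :: "nat \<Rightarrow> nat \<Rightarrow> nat"

definition neighbours :: "network \<Rightarrow> nat \<Rightarrow> nat set" where
  "neighbours N v = {u. (v, u) \<in> parcs (graph N)}"

definition degree :: "network \<Rightarrow> nat \<Rightarrow> nat" where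
  "degree N v = card (neighbours N v)"

definition valid_network :: "network \<Rightarrow> bool" where
  "valid_network N \<longleftrightarrow>
     pair_graph (graph N) \<and> Digraph_Component.connected (with_proj (graph N)) \<and>
     (\<forall>v \<in> pverts (graph N). bij_betw (port N v) (neighbours N v) {..<degree N v})"

definition size_of :: "network \<Rightarrow> nat" where
  "size_of N = card (pverts (graph N))"

definition distance :: "network \<Rightarrow> nat \<Rightarrow> nat \<Rightarrow> nat" where
  "distance N u v =
     (LEAST k. \<exists>p. pre_digraph.awalk (with_proj (graph N)) u p v \<and> length p = k)"

definition via_port :: "network \<Rightarrow> nat \<Rightarrow> nat \<Rightarrow> nat" where
  "via_port N v p = (THE u. u \<in> neighbours N v \<and> port N v u = p)"


section \<open>Agents\<close>

text \<open>A percept is the degree of the current node together with the entry port, or \<open>None\<close> if the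
  agent has not just entered the node (at wake-up, or after staying idle). The history lists one
  percept per round since wake-up, oldest first; past actions need not be recorded because the
  algorithm is deterministic.\<close>

type_synonym percept = "nat \<times> nat option"
type_synonym advice = "bool list"

text \<open>An algorithm maps the agent's label, the advice and the history to an action: \<open>None\<close> for
  staying, \<open>Some p\<close> for leaving through port \<open>p\<close>.\<close>

type_synonym algorithm = "nat \<Rightarrow> advice \<Rightarrow> percept list \<Rightarrow> nat option"

text \<open>Position and history after a given number of rounds since wake-up at node \<open>s\<close>. Choosing a
  port number that does not exist at the current node counts as staying.\<close>

fun run :: "network \<Rightarrow> (percept list \<Rightarrow> nat option) \<Rightarrow> nat \<Rightarrow> nat \<Rightarrow> nat \<times> percept list" where
  "run N act s 0 = (s, [(degree N s, None)])"
| "run N act s (Suc t) =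
     (let (v, h) = run N act s t;
          stay = (v, h @ [(degree N v, None)])
      in case act h of
           None \<Rightarrow> stay
         | Some p \<Rightarrow>
             if p < degree N v
             then let u = via_port N v p in (u, h @ [(degree N u, Some (port N u v))])
             else stay)"

text \<open>Position in (absolute) round \<open>t\<close> of an agent woken up at node \<open>s\<close> in round \<open>w\<close>. Natural
  subtraction truncates, so before its wake-up the agent is at \<open>s\<close>.\<close>

definition position :: "network \<Rightarrow> (percept list \<Rightarrow> nat option) \<Rightarrow> nat \<Rightarrow> nat \<Rightarrow> nat \<Rightarrow> nat" where
  "position N act s w t = fst (run N act s (t - w))"


section \<open>Rendezvous with advice\<close>

record instance_data =
  net :: network
  start1 :: nat
  start2 :: nat
  wake1 :: nat
  wake2 :: nat
  label1 :: nat
  label2 :: nat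

definition instances :: "nat \<Rightarrow> instance_data set" where
  "instances L = {I. valid_network (net I) \<and>
     start1 I \<in> pverts (graph (net I)) \<and> start2 I \<in> pverts (graph (net I)) \<and>
     start1 I \<noteq> start2 I \<and>
     label1 I \<in> {1..L} \<and> label2 I \<in> {1..L} \<and> label1 I \<noteq> label2 I}"

definition instances_with :: "nat \<Rightarrow> nat \<Rightarrow> nat \<Rightarrow> instance_data set" where
  "instances_with L n D =
     {I \<in> instances L. size_of (net I) = n \<and> distance (net I) (start1 I) (start2 I) = D}"

type_synonym oracle_fun = "instance_data \<Rightarrow> advice"

definition met_at :: "algorithm \<Rightarrow> advice \<Rightarrow> instance_data \<Rightarrow> nat \<Rightarrow> bool" where
  "met_at A adv I t \<longleftrightarrow>
     position (net I) (A (label1 I) adv) (start1 I) (wake1 I) t =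
     position (net I) (A (label2 I) adv) (start2 I) (wake2 I) t"

definition rendezvous :: "algorithm \<Rightarrow> advice \<Rightarrow> instance_data \<Rightarrow> bool" where
  "rendezvous A adv I \<longleftrightarrow> (\<exists>t. met_at A adv I t)"

text \<open>Rounds from the wake-up of the later agent until the first meeting; this is \<open>0\<close> (truncated
  subtraction) if the earlier agent reaches the other one before the latter wakes up.\<close>

definition rendezvous_time :: "algorithm \<Rightarrow> advice \<Rightarrow> instance_data \<Rightarrow> nat" where
  "rendezvous_time A adv I = (LEAST t. met_at A adv I t) - max (wake1 I) (wake2 I)"

definition solves_rendezvous :: "nat \<Rightarrow> algorithm \<Rightarrow> oracle_fun \<Rightarrow> bool" where
  "solves_rendezvous L A ora \<longleftrightarrow> (\<forall>I \<in> instances L. rendezvous A (ora I) I)"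

definition takes_time_at_most ::
    "nat \<Rightarrow> algorithm \<Rightarrow> oracle_fun \<Rightarrow> nat \<Rightarrow> nat \<Rightarrow> real \<Rightarrow> bool" where
  "takes_time_at_most L A ora n D T \<longleftrightarrow>
     (\<forall>I \<in> instances_with L n D.
        rendezvous A (ora I) I \<and> real (rendezvous_time A (ora I) I) \<le> T)"

definition advice_bound :: "nat \<Rightarrow> nat \<Rightarrow> nat \<Rightarrow> real" where
  "advice_bound n D L = real D * log 2 (real n / real D) + log 2 (log 2 (real L))"

end

theory Submission
  imports Defs "HOL-Library.Sublist" "HOL-Library.Countable_Set" "HOL-Library.FuncSet"
begin

text \<open>In a network that covers a small quotient the percepts, hence the moves, of an agent depend only
  on its label and the advice. This is used twice, always with simultaneous wake-up.

  For \<open>log log L\<close> the network is an oriented ring. Rounding the displacement of an agent to multiples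
  of \<open>D div 4\<close> at every multiple of \<open>D div 4\<close> rounds leaves only \<open>O(1)\<close> profiles per advice within
  \<open>O(D)\<close> rounds; labels with equal profiles for all advices of length at most \<open>B\<close> never meet, so \<open>L\<close>
  is at most a constant to the power \<open>2 ^ (B + 1)\<close>.

  For \<open>D log (n / D)\<close> take \<open>m + 1\<close> disjoint copies (layers) of a dumbbell, two large cliques joined by a
  long path, and for each \<open>i\<close> exchange the ends of one hidden clique edge between the layers \<open>i - 1\<close>
  and \<open>i\<close>, alternately in the right and in the left cliques. The result covers the dumbbell, so each
  agent follows a fixed walk in the dumbbell whatever the hidden edges are, and agents that start in the
  extreme layers can meet only if the sequence of hidden edges is a subsequence of the walk of
  the first agent followed by the reversed walk of the second one. Hence within \<open>T\<close> rounds a single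
  advice serves at most \<open>2 T choose m\<close> of the \<open>(q * q) ^ m\<close> choices of hidden edges. The size of the
  dumbbell depends on the constant \<open>c\<close> in the time bound \<open>c D\<close>, whereas \<open>n\<close> and \<open>D\<close> must not; this is
  why \<open>n = k * 2 ^ i\<close> and \<open>D = 2 ^ i - 1\<close> are built from powers of two.\<close>

section \<open>Networks and simulations\<close>

definition network_of ::
    "nat \<Rightarrow> (nat \<Rightarrow> nat \<Rightarrow> bool) \<Rightarrow> (nat \<Rightarrow> nat \<Rightarrow> nat) \<Rightarrow> network" where
  "network_of n adj prt =
     \<lparr>graph = \<lparr>pverts = {..<n}, parcs = {(u, v). u < n \<and> v < n \<and> adj u v}\<rparr>, port = prt\<rparr>"

lemma network_of_simps [simp]:
  "pverts (graph (network_of n adj prt)) = {..<n}"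
  "parcs (graph (network_of n adj prt)) = {(u, v). u < n \<and> v < n \<and> adj u v}"
  "port (network_of n adj prt) = prt"
  "size_of (network_of n adj prt) = n"
  by (auto simp: network_of_def size_of_def)

lemma pair_graph_network_of:
  assumes "\<And>u v. adj u v \<Longrightarrow> adj v u" "\<And>u. \<not> adj u u"
  shows "pair_graph (graph (network_of n adj prt))"
proof -
  have "finite {(u, v). u < n \<and> v < n \<and> adj u v}"
    by (rule finite_subset[of _ "{..<n} \<times> {..<n}"]) auto
  then show ?thesis
    by unfold_locales (use assms in \<open>auto simp: symmetric_def sym_def\<close>)
qed

section \<open>Distances certified by potential functions\<close>

lemma potential_imp_awalk:
  assumes wf: "pair_wf_digraph G" and s: "s \<in> pverts G"
    and zero: "\<And>v. v \<in> pverts G \<Longrightarrow> f v = 0 \<Longrightarrow> v = s"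
    and desc: "\<And>v k. v \<in> pverts G \<Longrightarrow> f v = Suc k \<Longrightarrow> \<exists>u. (u, v) \<in> parcs G \<and> f u = k"
    and v: "v \<in> pverts G"
  shows "\<exists>p. pre_digraph.awalk (with_proj G) s p v \<and> length p = f v"
proof -
  interpret pair_wf_digraph G by fact
  show ?thesis using v
  proof (induction "f v" arbitrary: v)
    case 0
    then have "v = s" using zero by simp
    then show ?case using 0 s by (auto simp: awalk_Nil_iff intro!: exI[of _ "[]"])
  next
    case (Suc k)
    then obtain u where u: "(u, v) \<in> parcs G" "f u = k" using desc[of v k] by auto
    then obtain p where p: "awalk s p u" "length p = k"
      using Suc.hyps(1)[of u] in_arcsD1 by blast
    have "awalk u [(u, v)] v" using u Suc.prems by (simp add: awalk_simps)
    then have "awalk s (p @ [(u, v)]) v" using p(1) by (rule awalk_appendI[rotated])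
    then show ?case using p(2) Suc.hyps(2) by (intro exI[of _ "p @ [(u, v)]"]) simp
  qed
qed

lemma awalk_potential_le:
  assumes wf: "pair_wf_digraph G"
    and lip: "\<And>u v. (u, v) \<in> parcs G \<Longrightarrow> f v \<le> Suc (f u)"
    and p: "pre_digraph.awalk (with_proj G) s p v"
  shows "f v \<le> f s + length p"
proof -
  interpret pair_wf_digraph G by fact
  show ?thesis using p
  proof (induction p arbitrary: s)
    case Nil
    then show ?case by (simp add: awalk_Nil_iff)
  next
    case (Cons e p)
    then have "e \<in> parcs G" "fst e = s" "awalk (snd e) p v"
      by (auto simp: awalk_Cons_iff)
    moreover from this have "f (snd e) \<le> Suc (f s)" using lip[of "fst e" "snd e"] by (metis prod.collapse)
    ultimately show ?case using Cons.IH[of "snd e"] by simp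
  qed
qed

text \<open>Descent yields a walk of length \<open>f v\<close>, and the Lipschitz condition excludes
  a shorter one. Both networks below therefore need only a suitable \<open>f\<close>, not an
  analysis of shortest paths.\<close>

lemma distance_eq_potential:
  fixes f :: "nat \<Rightarrow> nat"
  assumes "pair_wf_digraph (graph N)" "s \<in> pverts (graph N)" "f s = 0"
    and "\<And>v. v \<in> pverts (graph N) \<Longrightarrow> f v = 0 \<Longrightarrow> v = s"
    and "\<And>v k. v \<in> pverts (graph N) \<Longrightarrow> f v = Suc k \<Longrightarrow>
           \<exists>u. (u, v) \<in> parcs (graph N) \<and> f u = k"
    and "\<And>u v. (u, v) \<in> parcs (graph N) \<Longrightarrow> f v \<le> Suc (f u)"
    and "v \<in> pverts (graph N)"
  shows "distance N s v = f v"
  unfolding distance_def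
proof (rule Least_equality)
  show "\<exists>p. pre_digraph.awalk (with_proj (graph N)) s p v \<and> length p = f v"
    using assms by (intro potential_imp_awalk)
next
  fix k
  assume "\<exists>p. pre_digraph.awalk (with_proj (graph N)) s p v \<and> length p = k"
  then show "f v \<le> k"
    using awalk_potential_le[where f = f, OF assms(1,6)] assms(3) by fastforce
qed

lemma connected_if_potential:
  assumes pg: "pair_graph G" and "s \<in> pverts G"
    and "\<And>v. v \<in> pverts G \<Longrightarrow> f v = (0::nat) \<Longrightarrow> v = s"
    and "\<And>v k. v \<in> pverts G \<Longrightarrow> f v = Suc k \<Longrightarrow> \<exists>u. (u, v) \<in> parcs G \<and> f u = k"
  shows "Digraph_Component.connected (with_proj G)"
proof -
  interpret pair_graph G by fact
  have reach: "s \<rightarrow>\<^sup>*\<^bsub>with_proj G\<^esub> v" if v: "v \<in> pverts G" for v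
  proof -
    obtain p where "awalk s p v"
      using potential_imp_awalk[OF pair_wf_digraph_axioms assms(2,3,4) v] by blast
    then show ?thesis by (rule reachable_awalkI)
  qed
  have "u \<rightarrow>\<^sup>*\<^bsub>with_proj G\<^esub> v" if u: "u \<in> pverts G" and v: "v \<in> pverts G" for u v
    by (rule reachable_trans[OF symmetric_reachable[OF pair_sym_arcs reach[OF u]] reach[OF v]])
  then show ?thesis
    using assms(2) unfolding connected_def strongly_connected_def
    by (auto intro: reachable_mk_symmetricI)
qed

text \<open>\<open>nx\<close> and \<open>en\<close> give the successor and the entry port when leaving through a port.\<close>

fun quotient_run ::
    "('b \<Rightarrow> nat) \<Rightarrow> ('b \<Rightarrow> nat \<Rightarrow> 'b) \<Rightarrow> ('b \<Rightarrow> nat \<Rightarrow> nat) \<Rightarrow>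
     (percept list \<Rightarrow> nat option) \<Rightarrow> 'b \<Rightarrow> nat \<Rightarrow> 'b \<times> percept list" where
  "quotient_run dg nx en act b 0 = (b, [(dg b, None)])"
| "quotient_run dg nx en act b (Suc t) =
     (let (x, h) = quotient_run dg nx en act b t;
          stay = (x, h @ [(dg x, None)])
      in case act h of
           None \<Rightarrow> stay
         | Some p \<Rightarrow>
             if p < dg x then (nx x p, h @ [(dg (nx x p), Some (en x p))]) else stay)"

text \<open>An agent perceives only degrees and entry ports, and these agree on related nodes; so
  the histories agree, hence the chosen ports, hence the next nodes are related again. Since
  \<open>R\<close> is any relation, it serves both for a finite quotient and for the integer line
  above a ring.\<close>

lemma run_simulation:
  assumes "(s, b) \<in> R"
    and "\<And>v x. (v, x) \<in> R \<Longrightarrow> degree N v = dg x"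
    and "\<And>v x p. (v, x) \<in> R \<Longrightarrow> p < dg x \<Longrightarrow> (via_port N v p, nx x p) \<in> R"
    and "\<And>v x p. (v, x) \<in> R \<Longrightarrow> p < dg x \<Longrightarrow> port N (via_port N v p) v = en x p"
  shows "(fst (run N act s t), fst (quotient_run dg nx en act b t)) \<in> R \<and>
    snd (quotient_run dg nx en act b t) = snd (run N act s t)"
proof (induction t)
  case 0
  then show ?case using assms by simp
next
  case (Suc t)
  obtain v h where vh: "run N act s t = (v, h)" by fastforce
  obtain x where x: "quotient_run dg nx en act b t = (x, h)" "(v, x) \<in> R"
    using Suc vh by (metis prod.collapse fst_conv snd_conv)
  have d: "degree N v = dg x" using assms(2) x(2) .
  have step: "(via_port N v p, nx x p) \<in> R" "port N (via_port N v p) v = en x p"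
    "degree N (via_port N v p) = dg (nx x p)" if "p < dg x" for p
    using assms(2-4) x(2) that by blast+
  show ?case using x(2) by (auto simp: vh x(1) Let_def d step split: option.splits)
qed

lemma via_port:
  assumes "bij_betw (port N v) (neighbours N v) {..<degree N v}" "u \<in> neighbours N v"
  shows "via_port N v (port N v u) = u"
  using assms unfolding via_port_def bij_betw_def inj_on_def by blast

lemma via_port_neighbour:
  assumes "bij_betw (port N v) (neighbours N v) {..<degree N v}" "p < degree N v"
  shows "via_port N v p \<in> neighbours N v" "port N v (via_port N v p) = p"
proof -
  obtain u where "u \<in> neighbours N v" "port N v u = p"
    using assms unfolding bij_betw_def by (metis imageE lessThan_iff)
  then show "via_port N v p \<in> neighbours N v" "port N v (via_port N v p) = p"
    using via_port[OF assms(1)] by auto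
qed

lemma run_step:
  assumes "valid_network N" "fst (run N act s t) \<in> pverts (graph N)"
  shows "fst (run N act s (Suc t)) = fst (run N act s t) \<or>
    fst (run N act s (Suc t)) \<in> neighbours N (fst (run N act s t))"
  using via_port_neighbour(1) assms unfolding valid_network_def
  by (auto simp: Let_def split: option.splits prod.splits)

section \<open>Layered covers\<close>

text \<open>The layer reached from layer \<open>i\<close> over the base edge \<open>A\<close>.
  Truncation of \<open>i - 1\<close> in layer 0 is harmless, because \<open>E 0\<close> will not be
  an edge.\<close>

definition shift :: "(nat \<Rightarrow> nat set) \<Rightarrow> nat \<Rightarrow> nat set \<Rightarrow> nat" where
  "shift E i A = (if A = E (Suc i) then Suc i else if A = E i then i - 1 else i)"

text \<open>Node \<open>x\<close> of layer \<open>i\<close> is encoded as \<open>i * S + x\<close>.\<close>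

definition cover_adj :: "nat \<Rightarrow> (nat \<Rightarrow> nat \<Rightarrow> bool) \<Rightarrow> (nat \<Rightarrow> nat set) \<Rightarrow> nat \<Rightarrow> nat \<Rightarrow> bool" where
  "cover_adj S adj E v w \<longleftrightarrow>
     adj (v mod S) (w mod S) \<and> w div S = shift E (v div S) {v mod S, w mod S}"

definition base_nbs :: "nat \<Rightarrow> (nat \<Rightarrow> nat \<Rightarrow> bool) \<Rightarrow> nat \<Rightarrow> nat set" where
  "base_nbs S adj x = {y. y < S \<and> adj x y}"

text \<open>Ports number the base neighbours of the projected node and ignore layers, so they do not
  reveal which edges are exchanged.\<close>

definition cover :: "nat \<Rightarrow> nat \<Rightarrow> (nat \<Rightarrow> nat \<Rightarrow> bool) \<Rightarrow> (nat \<Rightarrow> nat set) \<Rightarrow> network" where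
  "cover M S adj E = network_of (M * S) (cover_adj S adj E)
     (\<lambda>v w. to_nat_on (base_nbs S adj (v mod S)) (w mod S))"

lemma finite_base_nbs: "finite (base_nbs S adj x)"
  by (simp add: base_nbs_def)

locale layered_cover =
  fixes M S :: nat and adj :: "nat \<Rightarrow> nat \<Rightarrow> bool" and E :: "nat \<Rightarrow> nat set"
  assumes S_pos: "0 < S" and adj_sym: "adj x y \<Longrightarrow> adj y x" and adj_irrefl: "\<not> adj x x"
    and E_first: "adj x y \<Longrightarrow> {x, y} \<noteq> E 0" and E_last: "adj x y \<Longrightarrow> {x, y} \<noteq> E M"
    and E_Suc: "i < M \<Longrightarrow> E i \<noteq> E (Suc i)"
begin

abbreviation "N \<equiv> cover M S adj E"

text \<open>Recrossing an edge returns to the original layer, which makes \<open>cover_adj\<close>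
  symmetric. No layer outside the range is entered because \<open>E 0\<close> and \<open>E M\<close>
  are not edges; distinctness of consecutive sets settles the order of the two tests in
  \<open>shift\<close>.\<close>

lemma shift_shift:
  assumes "adj x y" "i < M"
  shows "shift E i {x, y} < M" "shift E (shift E i {x, y}) {x, y} = i"
proof -
  consider "{x, y} = E (Suc i)" | "{x, y} \<noteq> E (Suc i)" "{x, y} = E i"
    | "{x, y} \<noteq> E (Suc i)" "{x, y} \<noteq> E i" by blast
  then have "shift E i {x, y} < M \<and> shift E (shift E i {x, y}) {x, y} = i"
  proof cases
    case 1
    then have "Suc i < M" using assms E_last[of x y] by (metis Suc_lessI)
    then show ?thesis using 1 E_Suc[of "Suc i"] by (simp add: shift_def)
  next
    case 2
    then have "0 < i" using assms E_first[of x y] by (metis gr0I)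
    then show ?thesis using 2 assms by (auto simp: shift_def)
  next
    case 3
    then show ?thesis using assms by (simp add: shift_def)
  qed
  then show "shift E i {x, y} < M" "shift E (shift E i {x, y}) {x, y} = i" by auto
qed

lemma level_less: "v < M * S \<Longrightarrow> v div S < M"
  by (simp add: less_mult_imp_div_less)

lemma cover_adj_less:
  assumes "v < M * S" "cover_adj S adj E v w"
  shows "w < M * S"
proof -
  have "w div S < M"
    using assms shift_shift(1)[of "v mod S" "w mod S" "v div S"] level_less
    by (auto simp: cover_adj_def)
  then show ?thesis using S_pos div_less_iff_less_mult by blast
qed

definition lift :: "nat \<Rightarrow> nat \<Rightarrow> nat" where
  "lift v y = shift E (v div S) {v mod S, y} * S + y"

lemma lift_div_mod: "y < S \<Longrightarrow> lift v y div S = shift E (v div S) {v mod S, y}"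
    "y < S \<Longrightarrow> lift v y mod S = y"
  by (auto simp: lift_def)

lemma neighbours_cover:
  assumes "v < M * S"
  shows "neighbours N v = lift v ` base_nbs S adj (v mod S)"
proof (intro equalityI subsetI)
  fix w assume "w \<in> neighbours N v"
  then have "cover_adj S adj E v w" by (auto simp: neighbours_def cover_def)
  then have "w = lift v (w mod S)" "w mod S \<in> base_nbs S adj (v mod S)"
    using S_pos by (auto simp: cover_adj_def lift_def base_nbs_def) (metis div_mult_mod_eq)
  then show "w \<in> lift v ` base_nbs S adj (v mod S)" by blast
next
  fix w assume "w \<in> lift v ` base_nbs S adj (v mod S)"
  then have "cover_adj S adj E v w"
    by (auto simp: base_nbs_def cover_adj_def lift_div_mod)
  then show "w \<in> neighbours N v"
    using cover_adj_less[OF assms] assms by (auto simp: neighbours_def cover_def)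
qed

lemma degree_cover:
  assumes "v < M * S"
  shows "degree N v = card (base_nbs S adj (v mod S))"
proof -
  have "inj_on (lift v) (base_nbs S adj (v mod S))"
    by (rule inj_on_inverseI[where g = "\<lambda>w. w mod S"]) (simp add: lift_div_mod base_nbs_def)
  then show ?thesis using assms by (simp add: degree_def neighbours_cover card_image)
qed

lemma port_cover: "port N v w = to_nat_on (base_nbs S adj (v mod S)) (w mod S)"
  by (simp add: cover_def)

lemma bij_port_cover:
  assumes "v < M * S"
  shows "bij_betw (port N v) (neighbours N v) {..<degree N v}"
proof -
  let ?B = "base_nbs S adj (v mod S)"
  have "bij_betw (\<lambda>w. w mod S) (lift v ` ?B) ?B"
    by (rule bij_betwI[where g = "lift v"]) (auto simp: base_nbs_def lift_div_mod)
  then have "bij_betw (to_nat_on ?B \<circ> (\<lambda>w. w mod S)) (lift v ` ?B) {..<card ?B}"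
    using to_nat_on_finite[OF finite_base_nbs] bij_betw_trans by blast
  then show ?thesis
    by (simp add: neighbours_cover degree_cover assms comp_def port_cover[abs_def])
qed

lemma via_port_cover:
  assumes "v < M * S" "p < card (base_nbs S adj (v mod S))"
  shows "via_port N v p < M * S"
    and "via_port N v p mod S = from_nat_into (base_nbs S adj (v mod S)) p"
proof -
  let ?B = "base_nbs S adj (v mod S)"
  have u: "via_port N v p \<in> neighbours N v" "port N v (via_port N v p) = p"
    using via_port_neighbour[OF bij_port_cover] assms degree_cover by auto
  then obtain y where y: "y \<in> ?B" "via_port N v p = lift v y"
    using neighbours_cover[OF assms(1)] by auto
  then have m: "via_port N v p mod S = y" by (simp add: lift_div_mod base_nbs_def)
  then have "to_nat_on ?B y = p" using u(2) by (simp add: port_cover)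
  then show "via_port N v p mod S = from_nat_into ?B p"
    using y(1) m finite_base_nbs by (metis countable_finite from_nat_into_to_nat_on)
  show "via_port N v p < M * S"
    using u(1) by (auto simp: neighbours_def cover_def)
qed

text \<open>Only \<open>S\<close> and \<open>adj\<close> enter this walk, so runs in all covers of
  the same base graph project to it, whatever \<open>E\<close> is.\<close>

definition base_run :: "(percept list \<Rightarrow> nat option) \<Rightarrow> nat \<Rightarrow> nat \<Rightarrow> nat \<times> percept list" where
  "base_run = quotient_run (\<lambda>x. card (base_nbs S adj x)) (\<lambda>x. from_nat_into (base_nbs S adj x))
     (\<lambda>x p. to_nat_on (base_nbs S adj (from_nat_into (base_nbs S adj x) p)) x)"

lemma run_cover:
  assumes "s < M * S"
  shows "fst (run N act s t) < M * S" "fst (run N act s t) mod S = fst (base_run act (s mod S) t)"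
proof -
  have "(fst (run N act s t), fst (base_run act (s mod S) t)) \<in> {(v, v mod S) |v. v < M * S}"
    unfolding base_run_def
    by (rule run_simulation[THEN conjunct1])
      (use assms degree_cover via_port_cover in \<open>auto simp: port_cover\<close>)
  then show "fst (run N act s t) < M * S"
    "fst (run N act s t) mod S = fst (base_run act (s mod S) t)" by auto
qed

lemma cover_adj_sym:
  assumes "v < M * S" "cover_adj S adj E v w"
  shows "cover_adj S adj E w v"
  using assms shift_shift(2)[of "v mod S" "w mod S" "v div S"] adj_sym level_less
  by (auto simp: cover_adj_def insert_commute)

lemma pair_graph_cover: "pair_graph (graph N)"
proof -
  let ?adj = "\<lambda>u v. u < M * S \<and> v < M * S \<and> cover_adj S adj E u v"
  have "graph N = graph (network_of (M * S) ?adj (port N))"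
    by (auto simp: cover_def network_of_def)
  moreover have "pair_graph \<dots>"
    by (rule pair_graph_network_of) (use cover_adj_sym adj_irrefl in \<open>auto simp: cover_adj_def\<close>)
  ultimately show ?thesis by simp
qed

text \<open>Crossing from layer \<open>i\<close> to layer \<open>i + 1\<close> requires traversing \<open>E (i + 1)\<close> at that moment, and the
  traversed edges of the base graph do not depend on \<open>E\<close>. Hence the climbed part of \<open>E\<close> is a
  subsequence of a fixed word.\<close>

definition base_word :: "(percept list \<Rightarrow> nat option) \<Rightarrow> nat \<Rightarrow> nat set list" where
  "base_word act t =
     map (\<lambda>r. {fst (base_run act 0 r), fst (base_run act 0 (Suc r))}) [0..<t]"

lemma base_word_Suc: "base_word act (Suc t) =
    base_word act t @ [{fst (base_run act 0 t), fst (base_run act 0 (Suc t))}]"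
  by (simp add: base_word_def)

lemma run_cover_level:
  fixes act
  assumes "valid_network N" "s < M * S" "s mod S = 0"
  defines "v \<equiv> \<lambda>t. fst (run N act s t)"
  defines "e \<equiv> \<lambda>t. {fst (base_run act 0 t), fst (base_run act 0 (Suc t))}"
  shows "v (Suc t) div S = v t div S \<or>
    v (Suc t) div S = Suc (v t div S) \<and> e t = E (Suc (v t div S)) \<or>
    Suc (v (Suc t) div S) = v t div S \<and> e t = E (v t div S)"
proof -
  have lt: "v t < M * S" "v t mod S = fst (base_run act 0 t)" for t
    using run_cover[OF assms(2)] assms(3) by (auto simp: v_def)
  have "v (Suc t) = v t \<or> v (Suc t) \<in> neighbours N (v t)"
    unfolding v_def by (rule run_step[OF assms(1)]) (use run_cover[OF assms(2)] in \<open>auto simp: cover_def\<close>)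
  then show ?thesis
  proof
    assume "v (Suc t) \<in> neighbours N (v t)"
    then have "cover_adj S adj E (v t) (v (Suc t))" by (simp add: neighbours_def cover_def)
    then have "v (Suc t) div S = shift E (v t div S) (e t)" and a: "adj (v t mod S) (v (Suc t) mod S)"
      unfolding e_def by (auto simp: cover_adj_def lt(2)[symmetric])
    moreover have "e t \<noteq> E 0" using E_first[OF a] by (simp add: e_def lt(2))
    ultimately show ?thesis by (cases "v t div S") (auto simp: shift_def split: if_splits)
  qed simp
qed

lemma subseq_upt_Suc_prefix:
  assumes "subseq (map f [a..<Suc i]) xs" shows "subseq (map f [a..<i]) (xs @ ys)"
proof -
  have "prefix (map f [a..<i]) (map f [a..<Suc i])" by (cases "a \<le> i") auto
  then show ?thesis
    using assms by (meson prefix_imp_subseq subseq_order.trans subseq_rev_drop_many)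
qed

text \<open>Induction over the rounds: a step up appends \<open>E (i + 1)\<close> to both sides,
  while a step down only shortens the left side to a prefix.\<close>

lemma climb_subseq:
  assumes "valid_network N" "0 < M"
  shows "subseq (map E [1..<Suc (fst (run N act 0 t) div S)]) (base_word act t)"
proof (induction t)
  case 0
  then show ?case by (simp add: base_word_def)
next
  case (Suc t)
  let ?i = "fst (run N act 0 t) div S" and ?j = "fst (run N act 0 (Suc t)) div S"
  let ?e = "{fst (base_run act 0 t), fst (base_run act 0 (Suc t))}"
  have "0 < M * S" using assms S_pos by simp
  from run_cover_level[OF assms(1) this, of act t]
  consider "?j = ?i" | "?j = Suc ?i" "?e = E (Suc ?i)" | "Suc ?j = ?i" by fastforce
  then show ?case
  proof cases
    case 1
    then show ?thesis
      unfolding base_word_Suc using Suc subseq_rev_drop_many by metis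
  next
    case 2
    have "[1..<Suc ?j] = [1..<Suc ?i] @ [Suc ?i]" using 2 by simp
    then have "map E [1..<Suc ?j] = map E [1..<Suc ?i] @ [E (Suc ?i)]" by simp
    then show ?thesis
      unfolding base_word_Suc using Suc 2 by (simp only: list_emb_append_mono subseq_order.order_refl)
  next
    case 3
    then show ?thesis
      unfolding base_word_Suc using Suc subseq_upt_Suc_prefix by metis
  qed
qed

text \<open>The second agent starts in the top layer and needs the highest sets first; hence its
  word is reversed and every round adds its edge at the front.\<close>

lemma descend_subseq:
  assumes "valid_network N" "0 < M"
  shows "subseq (map E [Suc (fst (run N act ((M - 1) * S) t) div S)..<M])
    (rev (base_word act t))"
proof (induction t)
  case 0
  then show ?case using assms(2) S_pos by (simp add: base_word_def)
next
  case (Suc t)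
  let ?i = "fst (run N act ((M - 1) * S) t) div S"
  let ?j = "fst (run N act ((M - 1) * S) (Suc t)) div S"
  let ?e = "{fst (base_run act 0 t), fst (base_run act 0 (Suc t))}"
  have s: "(M - 1) * S < M * S" using assms S_pos by simp
  have i: "?i < M" using run_cover(1)[OF s] level_less by blast
  have w: "rev (base_word act (Suc t)) = ?e # rev (base_word act t)" by (simp add: base_word_Suc)
  from run_cover_level[OF assms(1) s, of act t]
  consider "?j = ?i" | "?j = Suc ?i" | "Suc ?j = ?i" "?e = E ?i" by fastforce
  then show ?case
  proof cases
    case 1
    show ?thesis unfolding w 1 by (rule list_emb_Cons[OF Suc])
  next
    case 2
    have "suffix (map E [Suc ?j..<M]) (map E [Suc ?i..<M])"
      using 2 by (cases "Suc ?i < M") (auto simp: upt_conv_Cons suffix_Cons)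
    then have "subseq (map E [Suc ?j..<M]) (rev (base_word act t))"
      using Suc by (meson suffix_imp_subseq subseq_order.trans)
    then show ?thesis unfolding w by blast
  next
    case 3
    then have "map E [Suc ?j..<M] = E ?i # map E [Suc ?i..<M]"
      using i by (simp add: upt_conv_Cons)
    then show ?thesis unfolding w using Suc 3(2) by (simp only: subseq_Cons2_iff if_True simp_thms)
  qed
qed

lemma map_upt_split:
  fixes i :: nat
  assumes "i < M"
  shows "map f [1..<M] = map f [1..<Suc i] @ map f [Suc i..<M]"
proof -
  have "[1..<Suc i + (M - Suc i)] = [1..<Suc i] @ [Suc i..<Suc i + (M - Suc i)]"
    by (rule upt_add_eq_append) simp
  moreover have "Suc i + (M - Suc i) = M" using assms by simp
  ultimately show ?thesis by (metis map_append)
qed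

text \<open>At a meeting in layer \<open>i\<close>, the first agent accounts for \<open>E 1\<close>
  to \<open>E i\<close> and the second one for the remaining sets. The words extend to
  \<open>T\<close> instead of the meeting round, which may depend on \<open>E\<close>.\<close>

lemma meeting_subseq:
  assumes "valid_network N" "0 < M" "t \<le> T"
    and "fst (run N act1 0 t) = fst (run N act2 ((M - 1) * S) t)"
  shows "subseq (map E [1..<M]) (base_word act1 T @ rev (base_word act2 T))"
proof -
  let ?i = "fst (run N act1 0 t) div S"
  have "0 < M * S" using assms S_pos by simp
  then have "?i < M" using run_cover(1) level_less by blast
  then have "map E [1..<M] = map E [1..<Suc ?i] @ map E [Suc ?i..<M]"
    by (rule map_upt_split)
  then have s: "subseq (map E [1..<M]) (base_word act1 t @ rev (base_word act2 t))"
    using climb_subseq[OF assms(1,2), of act1 t] descend_subseq[OF assms(1,2), of act2 t] assms(4)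
    by (metis list_emb_append_mono)
  have w: "\<exists>ys. base_word act T = base_word act t @ ys" for act
  proof -
    have "[0..<t + (T - t)] = [0..<t] @ [t..<t + (T - t)]" by (rule upt_add_eq_append) simp
    then have "[0..<T] = [0..<t] @ [t..<T]" using assms(3) by simp
    then show ?thesis by (simp only: base_word_def map_append) blast
  qed
  obtain ys zs where "base_word act1 T = base_word act1 t @ ys"
    "base_word act2 T = base_word act2 t @ zs"
    using w[of act1] w[of act2] by blast
  moreover have "subseq (base_word act1 t @ rev (base_word act2 t))
      (base_word act1 t @ ys @ rev zs @ rev (base_word act2 t))"
    by (auto simp: subseq_append' intro: subseq_drop_many)
  ultimately show ?thesis using s by (auto intro: subseq_order.trans)
qed

end

text \<open>Pascal's recursion: a subsequence of \<open>x # xs\<close> is one of \<open>xs\<close>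
  or starts with \<open>x\<close>. Repeated letters may make these coincide, hence only an
  inequality.\<close>

lemma card_subseqs_length:
  "finite {ys. subseq ys xs \<and> length ys = m} \<and>
   card {ys. subseq ys xs \<and> length ys = m} \<le> length xs choose m"
proof (induction xs arbitrary: m)
  case Nil
  have "{ys. subseq ys ([]::'a list) \<and> length ys = m} = (if m = 0 then {[]} else {})"
    by auto
  then show ?case by auto
next
  case (Cons x xs)
  let ?A = "\<lambda>zs m. {ys. subseq ys zs \<and> length ys = m}"
  show ?case
  proof (cases m)
    case 0
    then have "?A (x # xs) m = {[]}" by auto
    then show ?thesis using 0 by auto
  next
    case (Suc k)
    have sub: "?A (x # xs) m \<subseteq> ?A xs m \<union> (#) x ` ?A xs k"
    proof
      fix ys assume "ys \<in> ?A (x # xs) m"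
      then show "ys \<in> ?A xs m \<union> (#) x ` ?A xs k"
        using Suc by (cases ys) (auto split: if_splits)
    qed
    have fin: "finite (?A xs m \<union> (#) x ` ?A xs k)" using Cons by blast
    have "card (?A (x # xs) m) \<le> card (?A xs m) + card ((#) x ` ?A xs k)"
      using card_mono[OF fin sub] card_Un_le order_trans by blast
    also have "\<dots> \<le> card (?A xs m) + card (?A xs k)"
      using Cons by (intro add_left_mono card_image_le) blast
    also have "\<dots> \<le> (length xs choose m) + (length xs choose k)"
      using Cons by (simp add: add_mono)
    finally show ?thesis using Suc finite_subset[OF sub fin] by simp
  qed
qed

section \<open>The cover of the dumbbell\<close>

definition dumbbell_adj :: "nat \<Rightarrow> nat \<Rightarrow> nat \<Rightarrow> nat \<Rightarrow> bool" where
  "dumbbell_adj q l x y \<longleftrightarrow> x \<noteq> y \<and>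
     (x \<le> 2 * q \<and> y \<le> 2 * q \<or> 2 * q + l \<le> x \<and> 2 * q + l \<le> y \<or> x = Suc y \<or> y = Suc x)"

text \<open>The cliques are the nodes up to \<open>2 * q\<close> and those from
  \<open>2 * q + l\<close> on. The offsets keep hidden edges off the two nodes where the path is
  attached.\<close>

definition side :: "nat \<Rightarrow> nat \<Rightarrow> nat \<Rightarrow> nat" where
  "side q l i = (if odd i then 2 * q + l + 1 else 0)"

text \<open>The dummy value \<open>{0}\<close> is not an edge, so nothing is exchanged below the first and above the last
  layer. It also makes node \<open>0\<close> of layer \<open>0\<close> the only zero of the potential below, which is the
  distance from that node.\<close>

definition hidden_edge :: "nat \<Rightarrow> nat \<Rightarrow> (nat \<times> nat) list \<Rightarrow> nat \<Rightarrow> nat set" where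
  "hidden_edge q l hs i = (if i = 0 \<or> length hs < i then {0}
     else {side q l i + fst (hs ! (i - 1)), side q l i + snd (hs ! (i - 1))})"

text \<open>Disjoint ranges for the two ends make a pair recoverable from its unordered edge and
  exclude loops.\<close>

definition tuples :: "nat \<Rightarrow> nat \<Rightarrow> (nat \<times> nat) list set" where
  "tuples q m = {hs. set hs \<subseteq> {..<q} \<times> {q..<2 * q} \<and> length hs = m}"

text \<open>A layer costs \<open>l + 3\<close>: one step off the entry edge, \<open>l + 1\<close>
  steps over the path into the far clique, one step over the next hidden edge. Truncated subtraction
  yields 0 throughout the near clique, and \<open>min\<close> makes the value constant beyond the
  path.\<close>

definition layer_pot :: "nat \<Rightarrow> nat \<Rightarrow> (nat \<times> nat) list \<Rightarrow> nat \<Rightarrow> nat \<Rightarrow> nat" where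
  "layer_pot q l hs i x = i * (l + 3) + (if x \<in> hidden_edge q l hs i then 0
     else Suc (min (Suc l) (if even i then x - 2 * q else 2 * q + l - x)))"

abbreviation dumbbell_cover :: "nat \<Rightarrow> nat \<Rightarrow> nat \<Rightarrow> (nat \<times> nat) list \<Rightarrow> network" where
  "dumbbell_cover q l S hs \<equiv>
     cover (Suc (length hs)) S (dumbbell_adj q l) (hidden_edge q l hs)"

text \<open>An odd number of hidden edges makes \<open>M\<close> even, so the dummy
  \<open>E M\<close> lies on the left like \<open>E 0\<close> and the alternation of sides extends
  to both ends.\<close>

locale dumbbell =
  fixes q l S :: nat and hs :: "(nat \<times> nat) list"
  assumes q_pos: "0 < q" and S_ge: "4 * q + l + 1 \<le> S"
    and hs: "set hs \<subseteq> {..<q} \<times> {q..<2 * q}" and odd_hs: "odd (length hs)"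
begin

abbreviation "E \<equiv> hidden_edge q l hs"
abbreviation "B \<equiv> dumbbell_adj q l"
abbreviation "M \<equiv> Suc (length hs)"

lemma E_eq:
  assumes "0 < i" "i \<le> length hs"
  obtains a b where "a < q" "q \<le> b" "b < 2 * q" "E i = {side q l i + a, side q l i + b}"
proof -
  have "hs ! (i - 1) \<in> set hs" using assms by simp
  then have "hs ! (i - 1) \<in> {..<q} \<times> {q..<2 * q}" using hs by blast
  then show thesis using that[of "fst (hs ! (i - 1))" "snd (hs ! (i - 1))"] assms
    by (auto simp: hidden_edge_def mem_Times_iff)
qed

lemma E_dummy [simp]: "E 0 = {0}" "E M = {0}"
  by (simp_all add: hidden_edge_def)

lemma E_even: "even i \<Longrightarrow> i \<le> M \<Longrightarrow> x \<in> E i \<Longrightarrow> x < 2 * q"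
proof (cases "0 < i \<and> i \<le> length hs")
  case True
  assume "even i" "x \<in> E i"
  moreover obtain a b where "a < q" "q \<le> b" "b < 2 * q" "E i = {side q l i + a, side q l i + b}"
    using True by (auto intro: E_eq[of i])
  ultimately show ?thesis by (auto simp: side_def)
next
  case False
  assume "x \<in> E i"
  then show ?thesis using False q_pos by (auto simp: hidden_edge_def)
qed

lemma E_odd:
  assumes "odd i" "i \<le> M" "x \<in> E i"
  shows "2 * q + l < x" "x < S"
proof -
  have "0 < i \<and> i \<le> length hs" using assms odd_hs by (cases "i = M") (auto simp: odd_pos)
  then obtain a b where "a < q" "q \<le> b" "b < 2 * q" "E i = {side q l i + a, side q l i + b}"
    by (auto intro: E_eq[of i])
  then have "x = 2 * q + l + 1 + a \<or> x = 2 * q + l + 1 + b" "a < q" "b < 2 * q"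
    using assms(1,3) by (auto simp: side_def)
  then show "2 * q + l < x" "x < S" using S_ge by linarith+
qed

lemma E_less: "i \<le> M \<Longrightarrow> x \<in> E i \<Longrightarrow> x < S"
  using E_even[of i x] E_odd(2)[of i x] S_ge by (cases "even i") auto

lemma E_disjoint: "i < M \<Longrightarrow> x \<in> E i \<Longrightarrow> x \<in> E (Suc i) \<Longrightarrow> False"
  using E_even[of i x] E_odd(1)[of i x] E_even[of "Suc i" x] E_odd(1)[of "Suc i" x]
  by (cases "even i") auto

lemma E_nonempty: "E i \<noteq> {}"
  by (simp add: hidden_edge_def)

sublocale layered_cover M S B E
proof
  show "0 < S" using S_ge by simp
  show "B x y \<Longrightarrow> B y x" for x y by (auto simp: dumbbell_adj_def)
  show "\<not> B x x" for x by (simp add: dumbbell_adj_def)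
  show "B x y \<Longrightarrow> {x, y} \<noteq> E 0" "B x y \<Longrightarrow> {x, y} \<noteq> E M" for x y
    by (auto simp: dumbbell_adj_def)
  show "i < M \<Longrightarrow> E i \<noteq> E (Suc i)" for i
    using E_disjoint[of i] E_nonempty[of i] by blast
qed

abbreviation "P \<equiv> layer_pot q l hs"

lemma P_zero: "P i x = 0 \<Longrightarrow> i = 0 \<and> x = 0"
  by (auto simp: layer_pot_def split: if_splits)

lemma P_lipschitz_layer:
  assumes "B x y" "i \<le> M" shows "P i y \<le> Suc (P i x)"
proof (cases "even i")
  case True
  then show ?thesis using assms E_even[of i x] E_even[of i y]
    by (auto simp: dumbbell_adj_def layer_pot_def)
next
  case False
  then show ?thesis using assms E_odd(1)[of i x] E_odd(1)[of i y]
    by (auto simp: dumbbell_adj_def layer_pot_def)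
qed

text \<open>The ends of \<open>E (Suc i)\<close> lie in the clique far from \<open>E i\<close>,
  where the potential is \<open>l + 2\<close> above \<open>i * (l + 3)\<close>.\<close>

lemma P_cross:
  assumes "i < M" "x \<in> E (Suc i)" "y \<in> E (Suc i)"
  shows "P (Suc i) y = Suc (P i x)"
proof -
  have "x \<notin> E i" using E_disjoint assms by blast
  then show ?thesis using assms E_even[of "Suc i" x] E_odd(1)[of "Suc i" x]
    by (cases "even i") (auto simp: layer_pot_def)
qed

lemma P_lipschitz:
  assumes "v < M * S" "cover_adj S B E v w"
  shows "P (w div S) (w mod S) \<le> Suc (P (v div S) (v mod S))"
proof -
  let ?i = "v div S" and ?x = "v mod S" and ?y = "w mod S"
  have B: "B ?x ?y" and j: "w div S = shift E ?i {?x, ?y}"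
    using assms by (auto simp: cover_adj_def)
  have i: "?i < M" using assms level_less by blast
  consider "{?x, ?y} = E (Suc ?i)" "w div S = Suc ?i" | "{?x, ?y} = E ?i" "Suc (w div S) = ?i"
    | "w div S = ?i"
    using j E_first[OF B] by (cases ?i) (auto simp: shift_def split: if_splits)
  then show ?thesis
  proof cases
    case 1
    then have "?x \<in> E (Suc ?i)" "?y \<in> E (Suc ?i)" by blast+
    then show ?thesis using P_cross[OF i, of ?x ?y] 1(2) by simp
  next
    case 2
    then have "?x \<in> E (Suc (w div S))" "?y \<in> E (Suc (w div S))" by auto
    then show ?thesis using P_cross[of "w div S" ?y ?x] i 2(2) by simp
  next
    case 3
    then show ?thesis using P_lipschitz_layer[OF B] i by simp
  qed
qed

text \<open>From an end of \<open>E i\<close> the step leads over that edge to layer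
  \<open>i - 1\<close>; elsewhere in the near clique it leads to an end of \<open>E i\<close>;
  otherwise it follows the path towards the near clique.\<close>

lemma P_descent:
  assumes "i < M" "x < S" "P i x = Suc k"
  shows "\<exists>j y. y < S \<and> j = shift E i {x, y} \<and> B x y \<and> P j y = k"
proof (cases "x \<in> E i")
  case True
  then have i: "0 < i" using assms by (cases i) (auto simp: layer_pot_def)
  then obtain a b where ab: "a < q" "q \<le> b" "b < 2 * q" "E i = {side q l i + a, side q l i + b}"
    using E_eq assms by (metis less_Suc_eq_le)
  have "\<exists>y. E i = {x, y} \<and> x \<noteq> y"
  proof (cases "x = side q l i + a")
    case True
    then show ?thesis using ab by (intro exI[of _ "side q l i + b"]) simp
  next
    case False
    then have "x = side q l i + b" using \<open>x \<in> E i\<close> ab(4) by simp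
    then show ?thesis using ab by (intro exI[of _ "side q l i + a"]) (simp add: insert_commute)
  qed
  then obtain y where y: "E i = {x, y}" "x \<noteq> y" by blast
  have "B x y" using y ab
    by (auto simp: dumbbell_adj_def side_def doubleton_eq_iff)
  moreover have "y < S" using E_less[of i y] assms y by auto
  moreover have "shift E i {x, y} = i - 1" using y E_Suc[OF assms(1)] by (auto simp: shift_def)
  moreover have "P (i - 1) y = k"
    using P_cross[of "i - 1" y x] i y assms by auto
  ultimately show ?thesis by (intro exI[of _ "i - 1"] exI[of _ y]) simp
next
  case False
  define d where "d = (if even i then x - 2 * q else 2 * q + l - x)"
  have P: "P i x = i * (l + 3) + Suc (min (Suc l) d)"
    using False by (simp add: layer_pot_def d_def)
  have "\<exists>y. y < S \<and> B x y \<and> {x, y} \<noteq> E (Suc i) \<and> P i y = k"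
  proof (cases "d = 0")
    case True
    obtain y where y: "y \<in> E i" using E_nonempty[of i] by blast
    then have ne: "x \<noteq> y" using False by blast
    have "B x y"
    proof (cases "even i")
      case e: True
      have "y < 2 * q" using E_even[OF e _ y] assms(1) by simp
      moreover have "x \<le> 2 * q" using True e by (simp add: d_def)
      ultimately show ?thesis using ne by (simp add: dumbbell_adj_def)
    next
      case o: False
      have "2 * q + l < y" using E_odd(1)[OF o _ y] assms(1) by simp
      moreover have "2 * q + l \<le> x" using True o by (simp add: d_def)
      ultimately show ?thesis using ne by (simp add: dumbbell_adj_def)
    qed
    moreover have "y < S" using E_less[OF _ y] assms(1) by simp
    moreover have "{x, y} \<noteq> E (Suc i)" using E_disjoint[OF assms(1), of y] y by auto
    moreover have "P i y = k" using P assms(3) y True by (simp add: layer_pot_def)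
    ultimately show ?thesis by blast
  next
    case nz: False
    define y where "y = (if even i then (if x \<le> 2 * q + l then x - 1 else 2 * q + l)
      else (if 2 * q \<le> x then x + 1 else 2 * q))"
    have mid: "2 * q \<le> y" "y \<le> 2 * q + l"
      using nz by (auto simp: y_def d_def split: if_splits)
    have "y \<notin> E j" if "j \<le> M" for j
      using mid E_even[of j y] E_odd(1)[of j y] that by (cases "even j") auto
    then have nE: "y \<notin> E i" "y \<notin> E (Suc i)" using assms(1) by auto
    have "B x y" using nz by (auto simp: y_def d_def dumbbell_adj_def split: if_splits)
    moreover have "y < S" using mid S_ge by simp
    moreover have "{x, y} \<noteq> E (Suc i)" using nE by blast
    moreover have "P i y = k"
      using P assms(3) nE nz by (auto simp: layer_pot_def y_def d_def split: if_splits)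
    ultimately show ?thesis by blast
  qed
  then obtain y where y: "y < S" "B x y" "{x, y} \<noteq> E (Suc i)" "P i y = k" by blast
  moreover have "shift E i {x, y} = i" using y False by (auto simp: shift_def)
  ultimately show ?thesis by metis
qed

definition pot :: "nat \<Rightarrow> nat" where
  "pot v = P (v div S) (v mod S)"

lemma pot_zero: "pot v = 0 \<Longrightarrow> v = 0"
  using P_zero[of "v div S" "v mod S"] div_mult_mod_eq[of v S] by (simp add: pot_def)

lemma pot_descent:
  assumes "v < M * S" "pot v = Suc k"
  shows "\<exists>u. (u, v) \<in> parcs (graph N) \<and> pot u = k"
proof -
  obtain j y where y: "y < S" "j = shift E (v div S) {v mod S, y}" "B (v mod S) y" "P j y = k"
    using P_descent[of "v div S" "v mod S" k] assms level_less S_pos by (auto simp: pot_def)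
  define u where "u = j * S + y"
  have u: "u div S = j" "u mod S = y" using y(1) by (auto simp: u_def)
  then have "cover_adj S B E v u" using y by (simp add: cover_adj_def)
  then have "cover_adj S B E u v" "u < M * S"
    using cover_adj_sym[OF assms(1)] cover_adj_less[OF assms(1)] by blast+
  then have "(u, v) \<in> parcs (graph N)" using assms(1) by (simp add: cover_def)
  moreover have "pot u = k" using u y(4) by (simp only: pot_def)
  ultimately show ?thesis by blast
qed

lemma valid_dumbbell_cover: "valid_network N"
proof -
  have "Digraph_Component.connected (with_proj (graph N))"
    using pair_graph_cover pot_zero pot_descent S_pos
    by (intro connected_if_potential[where s = 0 and f = pot]) (auto simp: cover_def)
  then show ?thesis
    using pair_graph_cover bij_port_cover by (auto simp: valid_network_def cover_def)
qed

text \<open>In the top layer, whose index is odd, node 0 lies in the clique opposite to the last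
  hidden edge, which adds \<open>l + 2\<close> to the cost of the layers below.\<close>

lemma distance_dumbbell_cover: "distance N 0 (length hs * S) = M * (l + 3) - 1"
proof -
  interpret G: pair_graph "graph N" by (rule pair_graph_cover)
  have "0 \<notin> E (length hs)" using E_odd(1)[OF odd_hs, of 0] by auto
  then have "pot (length hs * S) = M * (l + 3) - 1"
    using S_pos odd_hs q_pos by (simp add: pot_def layer_pot_def)
  moreover have "distance N 0 (length hs * S) = pot (length hs * S)"
  proof (rule distance_eq_potential)
    show "pair_wf_digraph (graph N)" ..
    show "pot 0 = 0" by (simp add: pot_def layer_pot_def)
    show "pot v = Suc k \<Longrightarrow> \<exists>u. (u, v) \<in> parcs (graph N) \<and> pot u = k"
      if "v \<in> pverts (graph N)" for v k
      using pot_descent that by (simp add: cover_def)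
    show "pot v \<le> Suc (pot u)" if "(u, v) \<in> parcs (graph N)" for u v
      using P_lipschitz that by (simp add: cover_def pot_def)
  qed (use pot_zero S_pos in \<open>auto simp: cover_def\<close>)
  ultimately show ?thesis by simp
qed

end

lemma card_tuples: "card (tuples q m) = (q * q) ^ m" "finite (tuples q m)"
proof -
  have "card ({..<q} \<times> {q..<2 * q}) = q * q" by (simp add: card_cartesian_product)
  then show "card (tuples q m) = (q * q) ^ m"
    unfolding tuples_def by (subst card_lists_length_eq) auto
  show "finite (tuples q m)" unfolding tuples_def by (rule finite_lists_length_eq) auto
qed

lemma hidden_edges_inj:
  "inj_on (\<lambda>hs. map (hidden_edge q l hs) [1..<Suc m]) (tuples q m)"
proof (rule inj_onI)
  fix hs hs' assume h: "hs \<in> tuples q m" "hs' \<in> tuples q m"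
    and eq: "map (hidden_edge q l hs) [1..<Suc m] = map (hidden_edge q l hs') [1..<Suc m]"
  have len: "length hs = m" "length hs' = m" using h by (auto simp: tuples_def)
  show "hs = hs'"
  proof (rule nth_equalityI)
    fix i assume i: "i < length hs"
    then have "Suc i \<in> set [1..<Suc m]" unfolding set_upt using len by simp
    then have "hidden_edge q l hs (Suc i) = hidden_edge q l hs' (Suc i)"
      using eq[unfolded map_eq_conv] by (rule bspec[rotated])
    moreover have "hs ! i \<in> set hs" "hs' ! i \<in> set hs'" using i len by auto
    then have "hs ! i \<in> {..<q} \<times> {q..<2 * q}" "hs' ! i \<in> {..<q} \<times> {q..<2 * q}"
      using h by (auto simp: tuples_def simp del: mem_Sigma_iff)
    ultimately show "hs ! i = hs' ! i"
      using i len by (cases "hs ! i"; cases "hs' ! i") (auto simp: hidden_edge_def doubleton_eq_iff)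
  qed (use len in simp)
qed

lemma card_met_tuples:
  assumes "0 < q" "4 * q + l + 1 \<le> S" "odd m"
  shows "card {hs \<in> tuples q m. \<exists>t \<le> T.
      fst (run (dumbbell_cover q l S hs) act1 0 t) =
      fst (run (dumbbell_cover q l S hs) act2 (m * S) t)} \<le> 2 * T choose m"
    (is "card ?A \<le> _")
proof -
  let ?br = "quotient_run (\<lambda>x. card (base_nbs S (dumbbell_adj q l) x))
     (\<lambda>x. from_nat_into (base_nbs S (dumbbell_adj q l) x))
     (\<lambda>x p. to_nat_on (base_nbs S (dumbbell_adj q l)
        (from_nat_into (base_nbs S (dumbbell_adj q l) x) p)) x)"
  define word where "word = (\<lambda>act.
     map (\<lambda>r. {fst (?br act 0 r), fst (?br act 0 (Suc r))}) [0..<T])"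
  define w where "w = word act1 @ rev (word act2)"
  let ?C = "{ys. subseq ys w \<and> length ys = m}"
  let ?f = "\<lambda>hs. map (hidden_edge q l hs) [1..<Suc m]"
  have "?f ` ?A \<subseteq> ?C"
  proof
    fix ys assume "ys \<in> ?f ` ?A"
    then obtain hs t where h: "hs \<in> tuples q m" "ys = ?f hs" "t \<le> T"
      and meet: "fst (run (dumbbell_cover q l S hs) act1 0 t) =
        fst (run (dumbbell_cover q l S hs) act2 (m * S) t)"
      by blast
    have len: "length hs = m" using h(1) by (simp add: tuples_def)
    interpret dumbbell q l S hs
      using h(1) assms by unfold_locales (auto simp: tuples_def)
    have "word = (\<lambda>act. base_word act T)"
      unfolding word_def base_word_def base_run_def ..
    then have "subseq (map E [1..<M]) w"
      unfolding w_def
      using meeting_subseq[OF valid_dumbbell_cover _ h(3), of act1 act2] meet len by simp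
    then show "ys \<in> ?C" using h len by simp
  qed
  moreover have "inj_on ?f ?A"
    by (rule inj_on_subset[OF hidden_edges_inj]) auto
  ultimately have "card ?A \<le> card ?C"
    using card_subseqs_length card_inj_on_le by blast
  also have "\<dots> \<le> length w choose m" using card_subseqs_length by blast
  also have "length w = 2 * T" by (simp add: w_def word_def)
  finally show ?thesis .
qed

section \<open>Counting advice\<close>

lemma meeting_within:
  assumes "takes_time_at_most L A ora n D T" "I \<in> instances_with L n D"
    and "wake1 I = 0" "wake2 I = 0"
  shows "\<exists>t. real t \<le> T \<and> fst (run (net I) (A (label1 I) (ora I)) (start1 I) t) =
    fst (run (net I) (A (label2 I) (ora I)) (start2 I) t)"
proof -
  have r: "rendezvous A (ora I) I" "real (rendezvous_time A (ora I) I) \<le> T"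
    using assms by (auto simp: takes_time_at_most_def)
  let ?t = "LEAST t. met_at A (ora I) I t"
  have "met_at A (ora I) I ?t" using r(1) unfolding rendezvous_def by (rule LeastI_ex)
  then show ?thesis using r(2) assms(3,4)
    by (intro exI[of _ ?t]) (simp add: met_at_def position_def rendezvous_time_def)
qed

definition advices :: "nat \<Rightarrow> advice set" where
  "advices B = {xs. length xs \<le> B}"

lemma finite_advices: "finite (advices B)"
  and card_advices: "card (advices B) \<le> 2 ^ (B + 1)"
proof -
  have eq: "advices B = {xs. set xs \<subseteq> UNIV \<and> length xs \<le> B}" by (simp add: advices_def)
  show "finite (advices B)" unfolding eq by (rule finite_lists_length_le) simp
  have "card (advices B) = (\<Sum>i\<le>B. 2 ^ i)"
    unfolding eq by (subst card_lists_length_le) (simp_all add: card_UNIV_bool)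
  also have "\<dots> \<le> 2 ^ (B + 1)" by (induction B) auto
  finally show "card (advices B) \<le> 2 ^ (B + 1)" .
qed

text \<open>Pigeonhole with fixed labels 1 and 2: the oracle sorts the tuples by advice, and the
  tuples served by one advice are bounded by \<open>card_met_tuples\<close>.\<close>

lemma dumbbell_advice_count:
  assumes "0 < q" "4 * q + l + 1 \<le> S" "odd m" "2 \<le> L"
    and D: "D = Suc m * (l + 3) - 1"
    and time: "takes_time_at_most L A ora (Suc m * S) D T"
    and len: "\<And>I. I \<in> instances_with L (Suc m * S) D \<Longrightarrow> length (ora I) \<le> B"
  shows "(q * q) ^ m \<le> 2 ^ (B + 1) * (2 * nat \<lfloor>T\<rfloor> choose m)"
proof -
  define inst where "inst = (\<lambda>hs. \<lparr>net = dumbbell_cover q l S hs, start1 = 0, start2 = m * S,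
    wake1 = 0, wake2 = 0, label1 = 1, label2 = 2\<rparr>)"
  define Met where "Met = (\<lambda>adv. {hs \<in> tuples q m. \<exists>t \<le> nat \<lfloor>T\<rfloor>.
      fst (run (dumbbell_cover q l S hs) (A 1 adv) 0 t) =
      fst (run (dumbbell_cover q l S hs) (A 2 adv) (m * S) t)})"
  have "tuples q m \<subseteq> (\<Union>adv \<in> advices B. Met adv)"
  proof
    fix hs assume h: "hs \<in> tuples q m"
    then have lh: "length hs = m" by (simp add: tuples_def)
    interpret dumbbell q l S hs
      using h assms by unfold_locales (auto simp: tuples_def)
    have I: "inst hs \<in> instances_with L (Suc m * S) D"
      using valid_dumbbell_cover distance_dumbbell_cover S_pos \<open>2 \<le> L\<close> lh odd_hs
      by (auto simp: inst_def instances_with_def instances_def D cover_def odd_pos)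
    obtain t where "real t \<le> T" "fst (run (dumbbell_cover q l S hs) (A 1 (ora (inst hs))) 0 t) =
      fst (run (dumbbell_cover q l S hs) (A 2 (ora (inst hs))) (m * S) t)"
      using meeting_within[OF time I] by (auto simp: inst_def)
    then have "hs \<in> Met (ora (inst hs))"
      using h le_nat_floor[of t T] unfolding Met_def by blast
    moreover have "ora (inst hs) \<in> advices B" using len[OF I] by (simp add: advices_def)
    ultimately show "hs \<in> (\<Union>adv \<in> advices B. Met adv)" by blast
  qed
  moreover have fin: "finite (Met adv)" for adv
    by (rule finite_subset[OF _ card_tuples(2)[of q m]]) (auto simp: Met_def)
  ultimately have "card (tuples q m) \<le> card (\<Union>adv \<in> advices B. Met adv)"
    using finite_advices by (intro card_mono) auto
  also have "\<dots> \<le> (\<Sum>adv \<in> advices B. card (Met adv))"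
    by (rule card_UN_le[OF finite_advices])
  also have "\<dots> \<le> (\<Sum>adv \<in> advices B. 2 * nat \<lfloor>T\<rfloor> choose m)"
    unfolding Met_def by (intro sum_mono card_met_tuples assms)
  also have "\<dots> = card (advices B) * (2 * nat \<lfloor>T\<rfloor> choose m)" by simp
  also have "\<dots> \<le> 2 ^ (B + 1) * (2 * nat \<lfloor>T\<rfloor> choose m)"
    using card_advices by (rule mult_right_mono) simp
  finally show ?thesis by (simp add: card_tuples)
qed

section \<open>Oriented rings\<close>

definition ring :: "nat \<Rightarrow> network" where
  "ring n = network_of n (\<lambda>u v. v = Suc u mod n \<or> u = Suc v mod n)
     (\<lambda>u v. if v = Suc u mod n then 0 else 1)"

lemma Suc_mod_if: "v < n \<Longrightarrow> Suc v mod n = (if Suc v = n then 0 else Suc v)"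
  by auto

lemma neighbours_ring:
  assumes "3 \<le> n" "v < n"
  shows "neighbours (ring n) v = {Suc v mod n, if v = 0 then n - 1 else v - 1}"
  using assms
  by (auto simp: neighbours_def ring_def Suc_mod_if split: if_splits dest: dvd_imp_le)

lemma port_ring: "port (ring n) u v = (if v = Suc u mod n then 0 else 1)"
  by (simp add: ring_def)

lemma pred_neq_Suc_mod:
  "3 \<le> n \<Longrightarrow> v < n \<Longrightarrow> Suc v mod n \<noteq> (if v = 0 then n - 1 else v - 1)"
  by (auto simp: Suc_mod_if)

lemma degree_ring: "3 \<le> n \<Longrightarrow> v < n \<Longrightarrow> degree (ring n) v = 2"
  using pred_neq_Suc_mod[of n v] by (simp add: degree_def neighbours_ring)

lemma bij_port_ring:
  assumes "3 \<le> n" "v < n"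
  shows "bij_betw (port (ring n) v) (neighbours (ring n) v) {..<degree (ring n) v}"
proof -
  have "{..<2::nat} = {0, 1}" by auto
  then show ?thesis
    using pred_neq_Suc_mod[OF assms] assms unfolding degree_ring[OF assms]
    by (auto simp: bij_betw_def inj_on_def neighbours_ring port_ring)
qed

lemma via_port_ring:
  assumes "3 \<le> n" "v < n"
  shows "via_port (ring n) v 0 = Suc v mod n"
    and "via_port (ring n) v 1 = (if v = 0 then n - 1 else v - 1)"
  using via_port[OF bij_port_ring[OF assms], of "Suc v mod n"]
    via_port[OF bij_port_ring[OF assms], of "if v = 0 then n - 1 else v - 1"]
    pred_neq_Suc_mod[OF assms]
  by (auto simp: neighbours_ring assms port_ring)

lemma ring_potential_descent:
  assumes "3 \<le> n" "v < n" "min v (n - v) = Suc k"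
  shows "\<exists>u. (u, v) \<in> parcs (graph (ring n)) \<and> min u (n - u) = k"
proof (cases "v \<le> n - v")
  case True
  then show ?thesis using assms by (intro exI[of _ "v - 1"]) (auto simp: ring_def Suc_mod_if)
next
  case False
  then show ?thesis using assms
    by (intro exI[of _ "Suc v mod n"]) (auto simp: ring_def Suc_mod_if)
qed

lemma pair_graph_ring: "3 \<le> n \<Longrightarrow> pair_graph (graph (ring n))"
proof -
  assume n: "3 \<le> n"
  let ?adj = "\<lambda>u v. u < n \<and> v < n \<and> (v = Suc u mod n \<or> u = Suc v mod n)"
  have "graph (ring n) = graph (network_of n ?adj (port (ring n)))"
    by (auto simp: ring_def network_of_def)
  moreover have "pair_graph \<dots>"
    by (rule pair_graph_network_of) (use n in \<open>auto simp: Suc_mod_if split: if_splits\<close>)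
  ultimately show ?thesis by simp
qed

lemma valid_ring: "3 \<le> n \<Longrightarrow> valid_network (ring n)"
proof -
  assume n: "3 \<le> n"
  have "Digraph_Component.connected (with_proj (graph (ring n)))"
    using pair_graph_ring[OF n] ring_potential_descent[OF n] n
    by (intro connected_if_potential[where s = 0 and f = "\<lambda>v. min v (n - v)"])
      (auto simp: ring_def min_def split: if_splits)
  then show ?thesis
    using pair_graph_ring[OF n] bij_port_ring[OF n] by (auto simp: valid_network_def ring_def)
qed

lemma distance_ring:
  assumes "3 \<le> n" "2 * D \<le> n"
  shows "distance (ring n) 0 D = D"
proof -
  interpret G: pair_graph "graph (ring n)" by (rule pair_graph_ring[OF assms(1)])
  have "distance (ring n) 0 D = min D (n - D)"
  proof (rule distance_eq_potential)
    show "pair_wf_digraph (graph (ring n))" ..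
    show "min v (n - v) = Suc k \<Longrightarrow>
        \<exists>u. (u, v) \<in> parcs (graph (ring n)) \<and> min u (n - u) = k"
      if "v \<in> pverts (graph (ring n))" for v k
      using ring_potential_descent[OF assms(1)] that by (simp add: ring_def)
    show "min v (n - v) \<le> Suc (min u (n - u))" if "(u, v) \<in> parcs (graph (ring n))" for u v
      using that by (auto simp: ring_def Suc_mod_if split: if_splits)
  qed (use assms in \<open>auto simp: ring_def min_def split: if_splits\<close>)
  then show ?thesis using assms by simp
qed

text \<open>The walk on the integer line, which covers every ring; orientation means that leaving
  through port \<open>p\<close> enters through \<open>1 - p\<close>. The walk depends on neither the
  ring nor the starting node.\<close>

definition displacement :: "(percept list \<Rightarrow> nat option) \<Rightarrow> nat \<Rightarrow> int" where
  "displacement act t = fst (quotient_run (\<lambda>_. 2) (\<lambda>d p. if p = 0 then d + 1 else d - 1)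
     (\<lambda>_ p. 1 - p) act 0 t)"

lemma displacement_0 [simp]: "displacement act 0 = 0"
  by (simp add: displacement_def)

lemma displacement_Suc: "\<bar>displacement act (Suc t) - displacement act t\<bar> \<le> 1"
  by (auto simp: displacement_def Let_def split: option.splits prod.splits)

lemma displacement_lipschitz: "\<bar>displacement act (t + r) - displacement act t\<bar> \<le> int r"
proof (induction r)
  case (Suc r)
  then show ?case using displacement_Suc[of act "t + r"] by simp
qed simp

lemma run_ring:
  assumes "3 \<le> n" "s < n"
  shows "int (fst (run (ring n) act s t)) = (int s + displacement act t) mod int n"
proof -
  let ?R = "{(v, d). v < n \<and> int v = (int s + d) mod int n}"
  have step: "int (Suc v mod n) = (int s + (d + 1)) mod int n"
    "int (if v = 0 then n - 1 else v - 1) = (int s + (d - 1)) mod int n"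
    if "v < n" "int v = (int s + d) mod int n" for v d
  proof -
    have "(int s + (d + 1)) mod int n = (int v + 1) mod int n"
      unfolding that(2) by (simp add: mod_simps add.assoc)
    then show "int (Suc v mod n) = (int s + (d + 1)) mod int n"
      by (simp add: zmod_int add.commute)
    have "(int s + (d - 1)) mod int n = (int v - 1) mod int n"
      unfolding that(2) by (simp add: mod_simps algebra_simps)
    also have "\<dots> = int (if v = 0 then n - 1 else v - 1)"
    proof (cases "v = 0")
      case True
      have "(int v - 1) mod int n = (int n - 1) mod int n"
        using True mod_add_self2[of "- 1" "int n"] by simp
      also have "\<dots> = int n - 1" using that(1) by (intro mod_pos_pos_trivial) auto
      finally show ?thesis using True that(1) by (simp add: of_nat_diff)
    next
      case False
      then have "(int v - 1) mod int n = int v - 1"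
        using that(1) by (intro mod_pos_pos_trivial) auto
      then show ?thesis using False by (simp add: of_nat_diff)
    qed
    finally show "int (if v = 0 then n - 1 else v - 1) = (int s + (d - 1)) mod int n" by simp
  qed
  have "(fst (run (ring n) act s t), displacement act t) \<in> ?R"
    unfolding displacement_def
  proof (rule run_simulation[THEN conjunct1])
    show "(s, 0) \<in> ?R" using assms by auto
    show "degree (ring n) v = 2" if "(v, d) \<in> ?R" for v and d :: int
      using that degree_ring[OF assms(1)] by simp
    fix v p :: nat and d :: int
    assume R: "(v, d) \<in> ?R" and "p < 2"
    then consider "p = 0" | "p = 1" by linarith
    then show "(via_port (ring n) v p, if p = 0 then d + 1 else d - 1) \<in> ?R"
    proof cases
      case 1
      then show ?thesis using via_port_ring(1)[OF assms(1), of v] step(1)[of v d] R by auto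
    next
      case 2
      then show ?thesis using via_port_ring(2)[OF assms(1), of v] step(2)[of v d] R by auto
    qed
    show "port (ring n) (via_port (ring n) v p) v = 1 - p"
      using \<open>p < 2\<close> R via_port_ring[OF assms(1), of v] assms(1)
      by (auto simp: port_ring Suc_mod_if less_2_cases_iff split: if_splits dest: dvd_imp_le)
  qed
  then show ?thesis by simp
qed

text \<open>Since the last sample each agent has drifted by less than \<open>\<delta>\<close>, and
  equal roundings differ by less than \<open>\<delta>\<close>; three such terms stay below
  \<open>D\<close>.\<close>

lemma displacement_close:
  assumes "displacement act (t div \<delta> * \<delta>) div int \<delta> = displacement act' (t div \<delta> * \<delta>) div int \<delta>"
    and "0 < \<delta>" "4 * \<delta> \<le> D"
  shows "\<bar>displacement act t - displacement act' t\<bar> < int D"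
proof -
  let ?s = "t div \<delta> * \<delta>"
  have grid: "\<bar>displacement act ?s - displacement act' ?s\<bar> < int \<delta>"
  proof -
    have "x - y < int \<delta>" if "x div int \<delta> = y div int \<delta>" for x y
    proof -
      have "x = y div int \<delta> * int \<delta> + x mod int \<delta>" "y = y div int \<delta> * int \<delta> + y mod int \<delta>"
        using that by (metis div_mult_mod_eq)+
      moreover have "x mod int \<delta> < int \<delta>" "0 \<le> y mod int \<delta>" using assms(2) by auto
      ultimately show ?thesis by linarith
    qed
    then show ?thesis using assms(1) by (simp add: abs_less_iff)
  qed
  have "\<bar>displacement a t - displacement a ?s\<bar> < int \<delta>" for a
  proof -
    have "\<bar>displacement a (?s + t mod \<delta>) - displacement a ?s\<bar> \<le> int (t mod \<delta>)"
      by (rule displacement_lipschitz)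
    then show ?thesis using assms(2) by (simp add: order.strict_trans1)
  qed
  from this[of act] this[of act'] grid assms(3) show ?thesis by linarith
qed

text \<open>A meeting would make \<open>n\<close> divide the signed gap between the agents, which
  lies strictly between 0 and \<open>2 * D\<close>, hence below \<open>n\<close>.\<close>

lemma no_meeting_on_ring:
  assumes "3 \<le> n" "2 * D \<le> n" "0 < D"
    and "\<bar>displacement act t - displacement act' t\<bar> < int D"
  shows "fst (run (ring n) act 0 t) \<noteq> fst (run (ring n) act' D t)"
proof
  assume eq: "fst (run (ring n) act 0 t) = fst (run (ring n) act' D t)"
  let ?x = "int D + displacement act' t - displacement act t"
  have "displacement act t mod int n = (int D + displacement act' t) mod int n"
    using run_ring[OF assms(1), of 0 act t] run_ring[OF assms(1), of D act' t] assms eq by simp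
  then have "int n dvd ?x" by (metis mod_eq_dvd_iff)
  moreover have "0 < ?x" "?x < int n" using assms by linarith+
  ultimately show False using zdvd_imp_le by fastforce
qed

lemma ring_label_bound:
  assumes n: "2 * D \<le> n" "4 \<le> D" and "0 < c"
    and time: "takes_time_at_most L A ora n D (c * real D)"
    and len: "\<And>I. I \<in> instances_with L n D \<Longrightarrow> length (ora I) \<le> B"
    and J: "J = nat \<lfloor>8 * c\<rfloor>"
  shows "L \<le> ((2 * J + 1) ^ (J + 1)) ^ 2 ^ (B + 1)"
proof -
  define \<delta> where "\<delta> = D div 4"
  \<comment> \<open>The bound \<open>D \<le> 8 * \<delta>\<close> limits the sample indices within
    \<open>c * D\<close> rounds to \<open>8 * c\<close>, which is the origin of
    \<open>J\<close>.\<close>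
  have \<delta>: "0 < \<delta>" "4 * \<delta> \<le> D" "D \<le> 8 * \<delta>" using n unfolding \<delta>_def by presburger+
  have n3: "3 \<le> n" using n by simp
  define sample where "sample = (\<lambda>l adv. restrict
    (\<lambda>j. displacement (A l adv) (j * \<delta>) div int \<delta>) {..J})"
  define prof where "prof = (\<lambda>l. restrict (sample l) (advices B))"
  \<comment> \<open>Sample \<open>j\<close> has displacement at most \<open>j * \<delta>\<close> in
    absolute value, so its rounding takes one of \<open>2 * J + 1\<close> values, at
    \<open>J + 1\<close> sample times for each advice.\<close>
  let ?P = "advices B \<rightarrow>\<^sub>E ({..J} \<rightarrow>\<^sub>E {- int J..int J})"
  have "prof l \<in> ?P" for l
  proof -
    have "displacement act (j * \<delta>) div int \<delta> \<in> {- int J..int J}" if "j \<le> J" for act j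
    proof -
      have "\<bar>displacement act (0 + j * \<delta>) - displacement act 0\<bar> \<le> int (j * \<delta>)"
        by (rule displacement_lipschitz)
      also have "\<dots> \<le> int J * int \<delta>" using that by (simp add: mult_right_mono)
      finally have "- int J * int \<delta> \<le> displacement act (j * \<delta>)"
        "displacement act (j * \<delta>) \<le> int J * int \<delta>" by auto
      then have "(- int J * int \<delta>) div int \<delta> \<le> displacement act (j * \<delta>) div int \<delta>"
        "displacement act (j * \<delta>) div int \<delta> \<le> (int J * int \<delta>) div int \<delta>"
        using \<delta>(1) by (blast intro: zdiv_mono1 of_nat_0_less_iff[THEN iffD2])+
      moreover have "(- int J * int \<delta>) div int \<delta> = - int J" "(int J * int \<delta>) div int \<delta> = int J"
        using \<delta>(1) by (simp_all only: nonzero_mult_div_cancel_right of_nat_eq_0_iff)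
      ultimately show ?thesis by simp
    qed
    then show ?thesis by (auto simp: prof_def sample_def)
  qed
  moreover have "inj_on prof {1..L}"
  proof (rule inj_onI, rule ccontr)
    fix l l' assume l: "l \<in> {1..L}" "l' \<in> {1..L}" "prof l = prof l'" "l \<noteq> l'"
    define I where "I = \<lparr>net = ring n, start1 = 0, start2 = D,
      wake1 = 0, wake2 = 0, label1 = l, label2 = l'\<rparr>"
    have I: "I \<in> instances_with L n D"
      using l n valid_ring[OF n3] distance_ring[OF n3 n(1)]
      by (auto simp: I_def instances_with_def instances_def ring_def)
    obtain t where t: "real t \<le> c * real D"
      "fst (run (ring n) (A l (ora I)) 0 t) = fst (run (ring n) (A l' (ora I)) D t)"
      using meeting_within[OF time I] by (auto simp: I_def)
    have "c * real D \<le> c * (8 * real \<delta>)"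
      using \<delta>(3) \<open>0 < c\<close> by (intro mult_left_mono) linarith+
    then have "real t \<le> 8 * c * real \<delta>" using t(1) by simp
    moreover have "real (t div \<delta>) * real \<delta> \<le> real t"
      by (metis of_nat_mult of_nat_le_iff div_times_less_eq_dividend)
    ultimately have "real (t div \<delta>) * real \<delta> \<le> 8 * c * real \<delta>" by linarith
    then have "t div \<delta> \<le> J" using \<delta>(1) J by (simp add: le_nat_floor)
    moreover have "ora I \<in> advices B" using len[OF I] by (simp add: advices_def)
    then have "sample l (ora I) = sample l' (ora I)"
      using fun_cong[OF l(3), of "ora I"] by (simp add: prof_def)
    then have "sample l (ora I) (t div \<delta>) = sample l' (ora I) (t div \<delta>)" by simp
    ultimately have "displacement (A l (ora I)) (t div \<delta> * \<delta>) div int \<delta> =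
        displacement (A l' (ora I)) (t div \<delta> * \<delta>) div int \<delta>"
      by (simp add: sample_def)
    then show False
      using no_meeting_on_ring[OF n3 n(1) _ displacement_close[OF _ \<delta>(1,2)]] t(2) n(2) by simp
  qed
  moreover have "finite ?P" using finite_advices by (intro finite_PiE) auto
  ultimately have "card {1..L} \<le> card ?P"
    by (intro card_inj_on_le[of prof]) auto
  also have "card ?P = ((2 * J + 1) ^ (J + 1)) ^ card (advices B)"
  proof -
    have "card {- int J..int J} = 2 * J + 1" by simp
    then show ?thesis using finite_advices by (simp only: card_funcsetE finite_atMost card_atMost Suc_eq_plus1)
  qed
  also have "\<dots> \<le> ((2 * J + 1) ^ (J + 1)) ^ 2 ^ (B + 1)"
    by (intro power_increasing card_advices one_le_power) simp
  finally show ?thesis by simp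
qed

text \<open>Combines \<open>N choose m \<le> N ^ m / m!\<close> with
  \<open>m! \<ge> (m / e) ^ m\<close>; the latter keeps a single term of the exponential
  series.\<close>

lemma binomial_le_exp_power:
  assumes "0 < m"
  shows "real (N choose m) \<le> (exp 1 * real N / real m) ^ m"
proof -
  have "real m ^ m / fact m \<le> exp (real m)"
  proof -
    have "(\<Sum>i\<in>{m}. inverse (fact i) *\<^sub>R real m ^ i) \<le> (\<Sum>i. inverse (fact i) *\<^sub>R real m ^ i)"
      by (rule sum_le_suminf) (use summable_exp_generic[of "real m"] in auto)
    then show ?thesis by (simp add: exp_def divide_inverse mult.commute)
  qed
  then have m: "real m ^ m \<le> exp 1 ^ m * fact m"
    by (simp add: pos_divide_le_eq flip: exp_of_nat_mult)
  have "real (N choose m) * fact m \<le> real N ^ m"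
    using binomial_fact_pow[of N m] by (metis of_nat_fact of_nat_le_iff of_nat_mult of_nat_power)
  then have "real (N choose m) * fact m * real m ^ m \<le> real N ^ m * (exp 1 ^ m * fact m)"
    using m by (intro mult_mono) auto
  then have "real (N choose m) * real m ^ m \<le> exp 1 ^ m * real N ^ m"
    by (simp add: algebra_simps)
  then show ?thesis
    using assms by (simp add: power_divide power_mult_distrib pos_le_divide_eq)
qed

section \<open>The lower bound\<close>

lemma loglog_advice_bound:
  assumes "0 < c"
  shows "\<exists>\<kappa>. \<forall>n D L A ora B. 2 * D \<le> n \<and> 4 \<le> D \<and> 2 \<le> L \<and>
    takes_time_at_most L A ora n D (c * real D) \<and>
    (\<forall>I \<in> instances_with L n D. length (ora I) \<le> B) \<longrightarrow>
    log 2 (log 2 (real L)) - \<kappa> \<le> real B"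
proof -
  define J where "J = nat \<lfloor>8 * c\<rfloor>"
  \<comment> \<open>Adding 1 gives \<open>C \<ge> 2\<close> even for \<open>J = 0\<close>, so that
    \<open>log 2 C\<close> is positive and can be passed to the outer logarithm.\<close>
  define C where "C = (2 * J + 1) ^ (J + 1) + 1"
  have "1 \<le> (2 * J + 1) ^ (J + 1)" by (rule one_le_power) simp
  then have C: "2 \<le> C" unfolding C_def by linarith
  have "log 2 (log 2 (real L)) - (1 + log 2 (log 2 (real C))) \<le> real B"
    if "2 * D \<le> n" "4 \<le> D" "2 \<le> L" "takes_time_at_most L A ora n D (c * real D)"
      "\<forall>I \<in> instances_with L n D. length (ora I) \<le> B" for n D L A ora B
  proof -
    have "L \<le> ((2 * J + 1) ^ (J + 1)) ^ 2 ^ (B + 1)"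
      using ring_label_bound[OF that(1,2) assms that(4) _ J_def] that(5) by blast
    also have "\<dots> \<le> C ^ 2 ^ (B + 1)" by (rule power_mono) (simp_all add: C_def)
    finally have "real L \<le> real C ^ 2 ^ (B + 1)" by (metis of_nat_le_iff of_nat_power)
    then have "log 2 (real L) \<le> log 2 (real C ^ 2 ^ (B + 1))"
      using that(3) by (intro log_mono) auto
    also have "\<dots> = 2 ^ (B + 1) * log 2 (real C)" using C by (simp add: log_nat_power)
    finally have "log 2 (real L) \<le> 2 ^ (B + 1) * log 2 (real C)" .
    moreover have "0 < log 2 (real L)" "0 < log 2 (real C)"
      using that(3) C by simp_all
    ultimately have "log 2 (log 2 (real L)) \<le> log 2 (2 ^ (B + 1) * log 2 (real C))"
      by (intro log_mono) auto
    also have "\<dots> = real (B + 1) + log 2 (log 2 (real C))"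
    proof -
      have "log 2 ((2::real) ^ (B + 1)) = real (B + 1)" by (subst log_nat_power) simp_all
      then show ?thesis
        using \<open>0 < log 2 (real C)\<close> by (simp only: log_mult_pos zero_less_power zero_less_numeral)
    qed
    finally show ?thesis by simp
  qed
  then show ?thesis by blast
qed

text \<open>Every \<open>s\<close> factors the same \<open>n\<close> and \<open>D\<close>: there are
  \<open>2 ^ (i - s)\<close> layers of size \<open>k * 2 ^ s\<close>, each costing
  \<open>l + 3 = 2 ^ s\<close>. Thus \<open>s\<close> can be adapted to \<open>c\<close> later while
  \<open>n\<close> and \<open>D\<close> stay fixed.\<close>

lemma dumbbell_power_bound:
  assumes k: "2 \<le> k" and "2 \<le> L" and c: "0 < c"
    and s: "2 \<le> s" "s < i"
    and time: "takes_time_at_most L A ora (k * 2 ^ i) (2 ^ i - 1) (c * real (2 ^ i - 1))"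
    and len: "\<And>I. I \<in> instances_with L (k * 2 ^ i) (2 ^ i - 1) \<Longrightarrow> length (ora I) \<le> B"
  defines "m \<equiv> 2 ^ (i - s) - 1"
  shows "real m * log 2 (real k ^ 2 * 2 ^ s / (768 * c)) \<le> real B + 1"
proof -
  define l :: nat where "l = 2 ^ s - 3"
  \<comment> \<open>Solves \<open>4 * q + 2 ^ s = k * 2 ^ s\<close>, so the required
    \<open>4 * q + l + 1\<close> nodes fit into a layer with two to spare.\<close>
  define q where "q = (k - 1) * 2 ^ (s - 2)"
  define T where "T = nat \<lfloor>c * real (2 ^ i - 1)\<rfloor>"
  have s4: "(2::nat) ^ s = 4 * 2 ^ (s - 2)"
    using power_add[of "2::nat" 2 "s - 2"] s(1) by (simp only: le_add_diff_inverse) simp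
  have "0 < (2::nat) ^ (s - 2)" by simp
  then have l: "l + 3 = 2 ^ s" using s4 unfolding l_def by linarith
  have M: "Suc m = 2 ^ (i - s)" by (simp add: m_def)
  have pow: "(2::nat) ^ (i - s) * 2 ^ s = 2 ^ i" using s(2) by (simp flip: power_add)
  have n: "Suc m * (k * 2 ^ s) = k * 2 ^ i" unfolding M using pow by (metis mult.left_commute)
  have D: "2 ^ i - 1 = Suc m * (l + 3) - 1" unfolding M l using pow by simp
  have odd: "odd m" using s(2) by (simp add: m_def)
  have "2 \<le> Suc m" unfolding M using s(2) self_le_power[of "2::nat" "i - s"] by simp
  then have m: "1 \<le> m" by simp
  have "4 * q + 2 ^ s = k * 2 ^ s"
    using k s4 by (cases k) (auto simp: q_def algebra_simps)
  then have S: "4 * q + l + 1 \<le> k * 2 ^ s" using l by linarith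
  have "0 < q" using k by (simp add: q_def)
  have count: "(q * q) ^ m \<le> 2 ^ (B + 1) * (2 * T choose m)"
    unfolding T_def
    by (rule dumbbell_advice_count[OF \<open>0 < q\<close> S odd \<open>2 \<le> L\<close> D])
      (use time len in \<open>simp_all add: n del: mult_Suc\<close>)
  have Mlam: "real (2 ^ i - 1) \<le> 2 * real m * 2 ^ s"
  proof -
    have "2 ^ i - 1 \<le> Suc m * 2 ^ s" unfolding M using pow by simp
    also have "\<dots> \<le> (2 * m) * 2 ^ s" using m by (intro mult_right_mono) auto
    finally have "real (2 ^ i - 1) \<le> real ((2 * m) * 2 ^ s)" by (rule of_nat_mono)
    then show ?thesis by simp
  qed
  \<comment> \<open>The factor 12 comes from \<open>e \<le> 3\<close>, the two words of length
    \<open>T\<close>, and \<open>m + 1 \<le> 2 * m\<close>.\<close>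
  have "exp 1 * real (2 * T) / real m \<le> 12 * c * 2 ^ s"
  proof -
    have "real T \<le> c * real (2 ^ i - 1)" using c by (simp add: T_def)
    also have "\<dots> \<le> c * (2 * real m * 2 ^ s)" using Mlam c by (intro mult_left_mono) auto
    finally have "exp 1 * real (2 * T) \<le> 3 * (2 * (c * (2 * real m * 2 ^ s)))"
      using exp_le by (intro mult_mono) auto
    then show ?thesis using m by (simp add: pos_divide_le_eq algebra_simps)
  qed
  then have "(exp 1 * real (2 * T) / real m) ^ m \<le> (12 * c * 2 ^ s) ^ m"
    by (intro power_mono) auto
  then have bin: "real (2 * T choose m) \<le> (12 * c * 2 ^ s) ^ m"
    using binomial_le_exp_power[of m "2 * T"] m by linarith
  have q: "real k * 2 ^ s \<le> 8 * real q"
  proof -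
    have "k * 2 ^ s \<le> 8 * q" using k s4 by (cases k) (auto simp: q_def algebra_simps)
    then have "real (k * 2 ^ s) \<le> real (8 * q)" by (rule of_nat_mono)
    then show ?thesis by simp
  qed
  \<comment> \<open>The lower bound \<open>(k * 2 ^ s / 8) ^ 2\<close> for \<open>q * q\<close>,
    divided by \<open>12 * c * 2 ^ s\<close>; hence 768 = 64 * 12.\<close>
  define X where "X = real k ^ 2 * 2 ^ s / (768 * c)"
  have X0: "0 < X" using k c by (simp add: X_def)
  have "X * (12 * c * 2 ^ s) = (real k * 2 ^ s) * (real k * 2 ^ s) / 64"
    using c by (simp add: X_def power2_eq_square)
  also have "\<dots> \<le> (8 * real q) * (8 * real q) / 64"
    by (intro divide_right_mono mult_mono[OF q q]) simp_all
  also have "\<dots> = real (q * q)" by simp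
  finally have "(X * (12 * c * 2 ^ s)) ^ m \<le> real (q * q) ^ m"
    using X0 c by (intro power_mono) auto
  also have "\<dots> \<le> 2 ^ (B + 1) * real (2 * T choose m)"
    using of_nat_mono[OF count, where 'a = real] by simp
  also have "\<dots> \<le> 2 ^ (B + 1) * (12 * c * 2 ^ s) ^ m"
    using bin by (intro mult_left_mono) auto
  finally have "X ^ m \<le> 2 ^ (B + 1)"
    using c by (simp add: power_mult_distrib)
  then have "log 2 (X ^ m) \<le> log 2 (2 ^ (B + 1))"
    using X0 by (intro log_mono) auto
  moreover have "log 2 ((2::real) ^ (B + 1)) = real B + 1"
    by (subst log_pow_cancel) simp_all
  ultimately show ?thesis using X0 by (simp only: log_nat_power less_imp_le X_def)
qed

text \<open>The last bound lets a large \<open>n\<close> force a large distance term: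
  \<open>log D \<le> D - 1 \<le> (D - 1) * log (n / D)\<close>, and adding
  \<open>log (n / D)\<close> turns the left side into \<open>log n\<close>.\<close>

lemma ratio_bounds:
  assumes "3 \<le> i" "2 \<le> k"
  defines "D \<equiv> 2 ^ i - 1" and "n \<equiv> k * 2 ^ i"
  shows "2 * real D \<le> real n" "log 2 (real n / real D) \<le> 2 * log 2 (real k)"
    "1 \<le> log 2 (real n / real D)" "log 2 (real n) \<le> real D * log 2 (real n / real D)"
proof -
  have "(2::nat) ^ 3 \<le> 2 ^ i" using assms(1) by (intro power_increasing) auto
  then have D7: "7 \<le> D" "2 ^ i \<le> 2 * D" by (auto simp: D_def)
  have "2 * D \<le> 2 * 2 ^ i" by (simp add: D_def)
  also have "\<dots> \<le> n" using assms(2) by (simp add: n_def)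
  finally have nD: "2 * D \<le> n" .
  then show nD': "2 * real D \<le> real n" by (metis of_nat_le_iff of_nat_mult of_nat_numeral)
  then have r2: "2 \<le> real n / real D" using D7 by (simp add: pos_le_divide_eq)
  then show l1: "1 \<le> log 2 (real n / real D)" by simp
  have "n \<le> k * (2 * D)" using D7(2) by (simp add: n_def)
  also have "\<dots> \<le> k * (k * D)" using assms(2) by simp
  finally have "real n \<le> real (k * (k * D))" by (rule of_nat_mono)
  then have "real n / real D \<le> real k ^ 2"
    using D7 by (simp add: pos_divide_le_eq power2_eq_square mult.assoc)
  then have "log 2 (real n / real D) \<le> log 2 (real k ^ 2)" using r2 by (intro log_mono) auto
  then show "log 2 (real n / real D) \<le> 2 * log 2 (real k)"
    using assms(2) by (simp add: log_nat_power)
  have "D \<le> 2 ^ (D - 1)"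
    using less_exp[of "D - 1"] by linarith
  then have "real D \<le> 2 ^ (D - 1)" by (metis of_nat_le_iff of_nat_numeral of_nat_power)
  then have "log 2 (real D) \<le> log 2 (2 ^ (D - 1))" using D7 by (intro log_mono) auto
  then have "log 2 (real D) \<le> real D - 1" using D7 by (simp add: of_nat_diff)
  also have "\<dots> \<le> (real D - 1) * log 2 (real n / real D)"
    using l1 D7 by (simp add: mult_le_cancel_left1)
  finally have "log 2 (real D) \<le> (real D - 1) * log 2 (real n / real D)" .
  moreover have "0 < real D" "0 < real n" using D7 nD by auto
  then have "log 2 (real n / real D) = log 2 (real n) - log 2 (real D)"
    by (simp add: log_divide)
  moreover have "real D * y = (real D - 1) * y + y" for y :: real
    by (simp add: left_diff_distrib)
  ultimately show "log 2 (real n) \<le> real D * log 2 (real n / real D)"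
    by smt
qed

text \<open>With \<open>2 ^ s \<ge> 768 * c\<close> the argument of the logarithm is at least
  \<open>k ^ 2\<close>. If \<open>i\<close> is too small for the chosen exponent \<open>r\<close>,
  then \<open>s = i - 1\<close> and \<open>m = 1\<close>, and the deficit of at most
  \<open>r\<close> goes into the additive constant.\<close>

lemma distance_advice_bound:
  assumes c: "0 < c"
  shows "\<exists>g \<kappa>. 0 < g \<and> g \<le> 1 \<and> (\<forall>i k L A ora B. 3 \<le> i \<and> 2 \<le> k \<and> 2 \<le> L \<and>
    takes_time_at_most L A ora (k * 2 ^ i) (2 ^ i - 1) (c * real (2 ^ i - 1)) \<and>
    (\<forall>I \<in> instances_with L (k * 2 ^ i) (2 ^ i - 1). length (ora I) \<le> B) \<longrightarrow>
    g * (real (2 ^ i - 1) * log 2 (real (k * 2 ^ i) / real (2 ^ i - 1))) - \<kappa> \<le> real B)"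
proof -
  obtain r0 where "768 * c < 2 ^ r0" using real_arch_pow[of 2 "768 * c"] by auto
  also have "2 ^ r0 \<le> (2::real) ^ (r0 + 2)" by (intro power_increasing) auto
  finally obtain r where r: "768 * c \<le> 2 ^ r" "2 \<le> r" by (metis le_add2 less_imp_le)
  \<comment> \<open>Compensates the factors lost in \<open>D \<le> 2 * m * 2 ^ r\<close> and
    \<open>log (n / D) \<le> 2 * log k\<close>.\<close>
  define g :: real where "g = 1 / (4 * 2 ^ r)"
  have "g * (real (2 ^ i - 1) * log 2 (real (k * 2 ^ i) / real (2 ^ i - 1))) - (1 + real r) \<le> real B"
    if i: "3 \<le> i" and k: "2 \<le> k" and L: "2 \<le> L"
      and time: "takes_time_at_most L A ora (k * 2 ^ i) (2 ^ i - 1) (c * real (2 ^ i - 1))"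
      and len: "\<forall>I \<in> instances_with L (k * 2 ^ i) (2 ^ i - 1). length (ora I) \<le> B"
    for i k L A ora B
  proof -
    define s where "s = min r (i - 1)"
    have s: "2 \<le> s" "s < i" "s \<le> r" using i r by (auto simp: s_def)
    define m :: nat where "m = 2 ^ (i - s) - 1"
    have bound: "real m * log 2 (real k ^ 2 * 2 ^ s / (768 * c)) \<le> real B + 1"
      unfolding m_def using dumbbell_power_bound[OF k L c s(1,2) time] len by blast
    have lk: "0 \<le> log 2 (real k)" using k by simp
    have "log 2 (real k ^ 2 * 2 ^ s / (768 * c)) = 2 * log 2 (real k) + real s - log 2 (768 * c)"
      using k c by (simp add: log_divide log_mult log_nat_power)
    moreover have "log 2 (768 * c) \<le> real r"
      using log_mono[of 2 "768 * c" "2 ^ r"] r(1) c by (simp add: log_nat_power)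
    ultimately have lb: "2 * log 2 (real k) + real s - real r \<le> log 2 (real k ^ 2 * 2 ^ s / (768 * c))"
      by linarith
    have main: "real m * (2 * log 2 (real k)) \<le> real B + 1 + real r"
    proof (cases "s = r")
      case True
      then have "real m * (2 * log 2 (real k)) \<le> real m * log 2 (real k ^ 2 * 2 ^ s / (768 * c))"
        using lb by (intro mult_left_mono) auto
      then show ?thesis using bound by linarith
    next
      case False
      then have "i - s = 1" using i by (auto simp: s_def)
      then have "m = 1" by (simp add: m_def)
      then show ?thesis using bound lb by simp
    qed
    have "i = (i - s) + s" using s by simp
    then have "(2::nat) ^ i = 2 ^ (i - s) * 2 ^ s" by (metis power_add)
    moreover have "(2::nat) ^ (i - s) \<le> 2 * m"
      using self_le_power[of "2::nat" "i - s"] s unfolding m_def by simp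
    ultimately have "2 ^ i - 1 \<le> (2 * m) * 2 ^ s"
      by (metis diff_le_self le_trans mult_le_mono1)
    then have "real (2 ^ i - 1) \<le> real ((2 * m) * 2 ^ s)" by (rule of_nat_mono)
    also have "\<dots> = 2 * real m * 2 ^ s" by simp
    also have "\<dots> \<le> 2 * real m * 2 ^ r"
      using s(3) by (intro mult_left_mono power_increasing) auto
    finally have D: "real (2 ^ i - 1) \<le> 2 * real m * 2 ^ r" .
    have "real (2 ^ i - 1) * log 2 (real (k * 2 ^ i) / real (2 ^ i - 1))
        \<le> (2 * real m * 2 ^ r) * (2 * log 2 (real k))"
      using D ratio_bounds[OF i k] by (intro mult_mono) auto
    then have "g * (real (2 ^ i - 1) * log 2 (real (k * 2 ^ i) / real (2 ^ i - 1)))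
        \<le> g * ((2 * real m * 2 ^ r) * (2 * log 2 (real k)))"
      by (intro mult_left_mono) (simp_all add: g_def)
    also have "\<dots> = real m * log 2 (real k)" by (simp add: g_def)
    also have "\<dots> \<le> real m * (2 * log 2 (real k))" using lk by (intro mult_left_mono) auto
    finally show ?thesis using main by linarith
  qed
  moreover have "1 \<le> (2::real) ^ r" by (rule one_le_power) simp
  then have "1 \<le> 4 * (2::real) ^ r" by linarith
  then have "0 < g" "g \<le> 1" by (simp_all add: g_def)
  ultimately show ?thesis by blast
qed

text \<open>If all advice were too short, adding the two lower bounds would give
  \<open>X + Z \<le> R\<close>, whereas the threshold \<open>K\<close> forces one of the two terms
  above \<open>R\<close>. In this way the additive constants disappear.\<close>

lemma advice_lower_bound:
  assumes c: "0 < c"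
  shows "\<exists>(\<gamma>::real) (K::nat). 0 < \<gamma> \<and> (\<forall>i k L A ora. 3 \<le> i \<and> 2 \<le> k \<and> 2 \<le> L \<and> K \<le> max (k * 2 ^ i) L \<and>
    takes_time_at_most L A ora (k * 2 ^ i) (2 ^ i - 1) (c * real (2 ^ i - 1)) \<longrightarrow>
    (\<exists>I \<in> instances_with L (k * 2 ^ i) (2 ^ i - 1).
       \<gamma> * advice_bound (k * 2 ^ i) (2 ^ i - 1) L \<le> real (length (ora I))))"
proof -
  obtain g \<kappa>1 where g: "0 < g" "g \<le> 1" and distance_part: "\<And>i k L A ora B.
    3 \<le> i \<Longrightarrow> 2 \<le> k \<Longrightarrow> 2 \<le> L \<Longrightarrow>
    takes_time_at_most L A ora (k * 2 ^ i) (2 ^ i - 1) (c * real (2 ^ i - 1)) \<Longrightarrow>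
    (\<forall>I \<in> instances_with L (k * 2 ^ i) (2 ^ i - 1). length (ora I) \<le> B) \<Longrightarrow>
    g * (real (2 ^ i - 1) * log 2 (real (k * 2 ^ i) / real (2 ^ i - 1))) - \<kappa>1 \<le> real B"
    using distance_advice_bound[OF c] by blast
  obtain \<kappa>2 where label_part: "\<And>n D L A ora B. 2 * D \<le> n \<Longrightarrow> 4 \<le> D \<Longrightarrow> 2 \<le> L \<Longrightarrow>
    takes_time_at_most L A ora n D (c * real D) \<Longrightarrow>
    (\<forall>I \<in> instances_with L n D. length (ora I) \<le> B) \<Longrightarrow>
    log 2 (log 2 (real L)) - \<kappa>2 \<le> real B"
    using loglog_advice_bound[OF c] by blast
  define R where "R = 2 * (\<kappa>1 + \<kappa>2) / g"
  \<comment> \<open>Serves both cases: \<open>n \<ge> K\<close> gives \<open>log n > R\<close>, and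
    \<open>L \<ge> K\<close> gives \<open>log (log L) > R\<close>, whence the double
    exponential.\<close>
  obtain K :: nat where K: "2 powr (2 powr R) + 2 powr R < real K"
    using reals_Archimedean2 by blast
  have "\<exists>I \<in> instances_with L (k * 2 ^ i) (2 ^ i - 1).
       g / 4 * advice_bound (k * 2 ^ i) (2 ^ i - 1) L \<le> real (length (ora I))"
    if i: "3 \<le> i" and k: "2 \<le> k" and L: "2 \<le> L" and KL: "K \<le> max (k * 2 ^ i) L"
      and time: "takes_time_at_most L A ora (k * 2 ^ i) (2 ^ i - 1) (c * real (2 ^ i - 1))"
    for i k L A ora
  proof (rule ccontr)
    define n where "n = k * 2 ^ i"
    define D :: nat where "D = 2 ^ i - 1"
    define X where "X = real D * log 2 (real n / real D)"
    define Z where "Z = log 2 (log 2 (real L))"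
    define B where "B = nat \<lfloor>g / 4 * (X + Z)\<rfloor>"
    assume "\<not> ?thesis"
    then have "\<forall>I \<in> instances_with L n D. real (length (ora I)) < g / 4 * (X + Z)"
      by (auto simp: advice_bound_def X_def Z_def n_def D_def not_le)
    then have len: "\<forall>I \<in> instances_with L n D. length (ora I) \<le> B"
      unfolding B_def by (meson le_nat_floor less_imp_le)
    have "log 2 (real 2) \<le> log 2 (real L)" using L by (intro log_mono) auto
    then have L1: "1 \<le> log 2 (real L)" by simp
    then have Z0: "0 \<le> Z" by (simp add: Z_def)
    note ratio = ratio_bounds[OF i k, folded n_def D_def]
    have "(2::nat) ^ 3 \<le> 2 ^ i" using i by (intro power_increasing) auto
    then have D4: "4 \<le> D" by (simp add: D_def)
    have X0: "0 \<le> X" using ratio(3) by (simp add: X_def)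
    have B: "real B \<le> g / 4 * (X + Z)"
      using g X0 Z0 unfolding B_def by (intro of_nat_floor) simp
    have "2 * D \<le> n" using ratio(1) by linarith
    then have "Z - \<kappa>2 \<le> real B"
      using label_part[of D n L A ora B] D4 L time len by (simp add: Z_def n_def D_def)
    moreover have "g * X - \<kappa>1 \<le> real B"
      using distance_part[OF i k L time] len by (simp add: X_def n_def D_def)
    \<comment> \<open>Scales the label bound to the factor \<open>g\<close> of the distance bound;
      \<open>2 * B\<close> then accounts for at most half of \<open>g * (X + Z)\<close>.\<close>
    moreover have "g * Z \<le> Z" using g Z0 by (simp add: mult_left_le_one_le)
    ultimately have "g / 2 * (X + Z) \<le> \<kappa>1 + \<kappa>2"
      using B by (simp add: algebra_simps)
    then have le: "X + Z \<le> R" using g by (simp add: R_def field_simps)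
    have "R < X \<or> R < Z"
    proof (cases "K \<le> n")
      case True
      then have "2 powr R < real n" using K powr_gt_zero[of 2 "2 powr R"] by linarith
      moreover from this have "0 < real n" using powr_gt_zero[of 2 R] by linarith
      ultimately have "R < log 2 (real n)" using less_log_iff[of 2 "real n" R] by simp
      then show ?thesis using ratio(4) by (simp add: X_def)
    next
      case False
      then have "K \<le> L" using KL by (simp add: n_def max_def split: if_splits)
      then have "2 powr (2 powr R) < real L"
        using K powr_gt_zero[of 2 R] of_nat_le_iff[of K L, where 'a = real] by linarith
      then have "2 powr R < log 2 (real L)" using less_log_iff[of 2 "real L" "2 powr R"] L by simp
      then show ?thesis using less_log_iff[of 2 "log 2 (real L)" R] L1 by (simp add: Z_def)
    qed
    then show False using le X0 Z0 by linarith
  qed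
  moreover have "0 < g / 4" using g by simp
  ultimately show ?thesis by blast
qed

text \<open>The quantifier order renders the asymptotic notation: the constants of both Theta are
  absolute, \<open>n\<close> and \<open>D\<close> are fixed before \<open>c\<close>, and
  \<open>\<gamma>\<close> and \<open>K\<close> depend on \<open>c\<close> alone. The Omega is
  understood for \<open>max n' L\<close> at least \<open>K c\<close>.\<close>

theorem theorem4:
  shows "\<exists>(a1::real) > 0. \<exists>(a2::real) > 0. \<exists>(b1::real) > 0. \<exists>(b2::real) > 0.
    \<exists>(\<gamma> :: real \<Rightarrow> real) (K :: real \<Rightarrow> nat). (\<forall>c > 0. \<gamma> c > 0) \<and>
      (\<forall>(D'::nat) (n'::nat) (L::nat) (A :: algorithm).
         1 \<le> D' \<and> D' \<le> n' \<and> 2 \<le> L \<and> (\<exists>ora. solves_rendezvous L A ora) \<longrightarrow>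
         (\<exists>(n::nat) (D::nat).
            a1 * real n' \<le> real n \<and> real n \<le> a2 * real n' \<and>
            b1 * real D' \<le> real D \<and> real D \<le> b2 * real D' \<and>
            (\<forall>(c::real) > 0. \<forall>ora.
               K c \<le> max n' L \<and> takes_time_at_most L A ora n D (c * real D) \<longrightarrow>
               (\<exists>I \<in> instances_with L n D.
                  \<gamma> c * advice_bound n D L \<le> real (length (ora I))))))"
proof -
  obtain \<gamma> :: "real \<Rightarrow> real" and K :: "real \<Rightarrow> nat" where
    \<gamma>: "\<And>c. 0 < c \<Longrightarrow> 0 < \<gamma> c" and lower: "\<And>c i k L A ora. 0 < c \<Longrightarrow> 3 \<le> i \<Longrightarrow> 2 \<le> k \<Longrightarrow>
      2 \<le> L \<Longrightarrow> K c \<le> max (k * 2 ^ i) L \<Longrightarrow>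
      takes_time_at_most L A ora (k * 2 ^ i) (2 ^ i - 1) (c * real (2 ^ i - 1)) \<Longrightarrow>
      \<exists>I \<in> instances_with L (k * 2 ^ i) (2 ^ i - 1).
        \<gamma> c * advice_bound (k * 2 ^ i) (2 ^ i - 1) L \<le> real (length (ora I))"
    using advice_lower_bound by metis
  have sizes: "\<exists>n D. 8 * real n' \<le> real n \<and> real n \<le> 32 * real n' \<and>
      7 * real D' \<le> real D \<and> real D \<le> 16 * real D' \<and>
      (\<forall>c > 0. \<forall>ora. K c \<le> max n' L \<and> takes_time_at_most L A ora n D (c * real D) \<longrightarrow>
        (\<exists>I \<in> instances_with L n D. \<gamma> c * advice_bound n D L \<le> real (length (ora I))))"
    if D': "1 \<le> D'" "D' \<le> n'" and L: "2 \<le> L" for D' n' L and A :: algorithm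
  proof -
    obtain j where j: "2 ^ j \<le> D'" "D' < 2 ^ Suc j" using ex_power_ivl1[of 2 D'] D' by auto
    \<comment> \<open>Puts \<open>2 ^ i\<close> between \<open>8 * D'\<close> and
      \<open>16 * D'\<close> and ensures \<open>3 \<le> i\<close>; subtracting 1 lowers the first
      bound to \<open>7 * D'\<close>.\<close>
    define i where "i = j + 4"
    have i: "3 \<le> i" "8 * D' \<le> 2 ^ i" "2 ^ i \<le> 16 * D'"
      using j by (auto simp: i_def power_add)
    \<comment> \<open>The added 1 rounds the quotient up, so \<open>k * D'\<close> lies between
      \<open>n'\<close> and \<open>2 * n'\<close>, and it gives \<open>k \<ge> 2\<close> even for
      \<open>n' = D'\<close>.\<close>
    define k where "k = n' div D' + 1"
    have "1 \<le> n' div D'" using D' by (simp add: div_greater_zero_iff Suc_le_eq)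
    then have k: "2 \<le> k" by (simp add: k_def)
    have kD: "n' \<le> k * D'" "k * D' \<le> 2 * n'"
    proof -
      have "k * D' = n' div D' * D' + D'" by (simp add: k_def)
      moreover have "n' = n' div D' * D' + n' mod D'" by simp
      moreover have "n' mod D' < D'" using D' by simp
      ultimately show "n' \<le> k * D'" "k * D' \<le> 2 * n'" using D' by linarith+
    qed
    have lo: "8 * n' \<le> k * 2 ^ i"
    proof -
      have "8 * n' \<le> k * (8 * D')" using kD(1) by simp
      also have "\<dots> \<le> k * 2 ^ i" using i(2) by (rule mult_le_mono2)
      finally show ?thesis .
    qed
    have up: "k * 2 ^ i \<le> 32 * n'"
    proof -
      have "k * 2 ^ i \<le> k * (16 * D')" using i(3) by (rule mult_le_mono2)
      also have "\<dots> = 16 * (k * D')" by (simp only: ac_simps)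
      also have "\<dots> \<le> 32 * n'" using kD(2) by linarith
      finally show ?thesis .
    qed
    have D: "7 * D' \<le> 2 ^ i - 1" "2 ^ i - 1 \<le> 16 * D'" using i D' by linarith+
    have "\<exists>I \<in> instances_with L (k * 2 ^ i) (2 ^ i - 1).
        \<gamma> c * advice_bound (k * 2 ^ i) (2 ^ i - 1) L \<le> real (length (ora I))"
      if "0 < c" "K c \<le> max n' L"
        "takes_time_at_most L A ora (k * 2 ^ i) (2 ^ i - 1) (c * real (2 ^ i - 1))" for c ora
      \<comment> \<open>The threshold carries over from \<open>n'\<close> to \<open>n\<close>
        because \<open>n' \<le> 8 * n' \<le> k * 2 ^ i\<close>.\<close>
      using lower[OF that(1) i(1) k L _ that(3)] that(2) lo by linarith
    moreover have "8 * real n' \<le> real (k * 2 ^ i)" "real (k * 2 ^ i) \<le> 32 * real n'"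
      "7 * real D' \<le> real (2 ^ i - 1)" "real (2 ^ i - 1) \<le> 16 * real D'"
      using of_nat_mono[OF lo, where 'a = real] of_nat_mono[OF up, where 'a = real]
        of_nat_mono[OF D(1), where 'a = real] of_nat_mono[OF D(2), where 'a = real]
      by (simp_all only: of_nat_mult of_nat_numeral)
    ultimately show ?thesis by blast
  qed
  show ?thesis
    by (rule exI[of _ 8], rule conjI, simp, rule exI[of _ 32], rule conjI, simp,
        rule exI[of _ 7], rule conjI, simp, rule exI[of _ 16], rule conjI, simp,
        rule exI[of _ \<gamma>], rule exI[of _ K])
      (use \<gamma> sizes in simp)
qed

end
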